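(* Let $p(y;\theta)$ be the density of the multivariate Gaussian distribution with mean $\theta$ and known positive definite covariance $\Sigma$, and for $r\ge0$ and $\mu_r\in\{\mu_r^1,\mu_r^2\}$ (defined in the context) let $$p_r(y)=\int_\Theta p(y;\theta')\mu_r(d\theta'),\qquad L(r,\theta)=\int_{\mathcal Y}\frac{(p(y;\theta))^2}{p_r(y)}dy,\qquad l(r)=\sup_{\theta\in\mathcal U_{data}}L(r,\theta).$$ Then $l^+(0)=\lim_{r\downarrow0}\frac{l(r)-l(0)}r<0$ for both $\mu_r=\mu_r^1$ and $\mu_r=\mu_r^2$.
   Context: $D,n\ge1$, $\alpha\in(0,1)$, $\chi^2_{1-\alpha,D}$ is the $1-\alpha$ quantile of the $\chi^2$-distribution with $D$ degrees of freedom, $\mathcal Y=\mathbb R^D$, and $\hat\theta$ is fixed. $\mu^1_r$ is the law of $\hat\theta+\Sigma^{1/2}\eta_{\sqrt r}$, where $\eta_{\sqrt r}$ is uniformly distributed inside the $D$-dimensional ball of radius $\sqrt r$ centered at the origin; $\mu_r^2=\mathcal N(\hat\theta,r\Sigma)$. For $r=0$ both are the point mass $\delta_{\hat\theta}$, so $p_0(y)=p(y;\hat\theta)$. The parameter space $\Theta\subset\mathbb R^D$ is taken large enough to contain the relevant supports (e.g. $\Theta=\mathbb R^D$). With $\chi^2(\mathbb P_1,\mathbb P_2)=\int(\frac{d\mathbb P_2}{d\mathbb P_1}-1)^2d\mathbb P_1$ and $\mathbb P_\theta=\mathcal N(\theta,\Sigma)$, $$\mathcal U_{data}=\Big\{\theta:\chi^2(\mathbb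 P_{\hat\theta},\mathbb P_\theta)\le\tfrac{\chi^2_{1-\alpha,D}}n\Big\}=\Big\{\hat\theta+\Sigma^{1/2}v:\|v\|_2^2\le\log\big(1+\tfrac{\chi^2_{1-\alpha,D}}n\big)\Big\}.$$ *)

theory Defs
  imports "HOL-Probability.Probability"
begin

definition pos_def :: "real^'n^'n \<Rightarrow> bool" where
  "pos_def A \<longleftrightarrow> transpose A = A \<and> (\<forall>x. x \<noteq> 0 \<longrightarrow> 0 < x \<bullet> (A *v x))"

definition pos_semidef :: "real^'n^'n \<Rightarrow> bool" where
  "pos_semidef A \<longleftrightarrow> transpose A = A \<and> (\<forall>x. 0 \<le> x \<bullet> (A *v x))"

definition matrix_sqrt :: "real^'n^'n \<Rightarrow> real^'n^'n" where
  "matrix_sqrt A = (THE S. pos_semidef S \<and> S ** S = A)"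

definition mvn_density :: "real^'n \<Rightarrow> real^'n^'n \<Rightarrow> real^'n \<Rightarrow> real" where
  "mvn_density m S y =
     exp (- ((y - m) \<bullet> (matrix_inv S *v (y - m))) / 2) / sqrt ((2 * pi) ^ CARD('n) * det S)"

definition mvn :: "real^'n \<Rightarrow> real^'n^'n \<Rightarrow> (real^'n) measure" where
  "mvn m S = density lborel (\<lambda>y. ennreal (mvn_density m S y))"

definition chi_square_dist :: "nat \<Rightarrow> real measure" where
  "chi_square_dist k =
     distr (Pi\<^sub>M {..<k} (\<lambda>_. density lborel (\<lambda>x. ennreal (std_normal_density x)))) borel
       (\<lambda>x. \<Sum>i<k. (x i)\<^sup>2)"

definition quantile :: "real measure \<Rightarrow> real \<Rightarrow> real" where
  "quantile M p = Inf {x. p \<le> cdf M x}"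

text \<open>The divergence \<open>\<chi>\<^sup>2(P\<^sub>1, P\<^sub>2)\<close> integrates over its first argument; it is infinite unless
  the second argument is absolutely continuous with respect to the first.\<close>

definition chi2_divergence :: "'a measure \<Rightarrow> 'a measure \<Rightarrow> ennreal" where
  "chi2_divergence P1 P2 =
     (if absolutely_continuous P1 P2
      then \<integral>\<^sup>+ x. ennreal ((enn2real (RN_deriv P1 P2 x) - 1)\<^sup>2) \<partial>P1
      else \<infinity>)"

definition U_data :: "real^'n \<Rightarrow> real^'n^'n \<Rightarrow> real \<Rightarrow> nat \<Rightarrow> (real^'n) set" where
  "U_data th S \<alpha> n =
     {\<theta>. chi2_divergence (mvn th S) (mvn \<theta> S)
          \<le> ennreal (quantile (chi_square_dist CARD('n)) (1 - \<alpha>) / real n)}"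

definition mu_ball :: "real^'n \<Rightarrow> real^'n^'n \<Rightarrow> real \<Rightarrow> (real^'n) measure" where
  "mu_ball th S r =
     (if r = 0 then return borel th
      else distr (uniform_measure lborel (cball 0 (sqrt r))) borel (\<lambda>v. th + matrix_sqrt S *v v))"

definition mu_gauss :: "real^'n \<Rightarrow> real^'n^'n \<Rightarrow> real \<Rightarrow> (real^'n) measure" where
  "mu_gauss th S r = (if r = 0 then return borel th else mvn th (r *\<^sub>R S))"

text \<open>The parameter space is all of \<open>\<real>\<^sup>D\<close>: the supports of either family, taken over all \<open>r \<ge> 0\<close>,
  already exhaust it.\<close>

definition mix_density :: "real^'n^'n \<Rightarrow> (real^'n) measure \<Rightarrow> real^'n \<Rightarrow> real" where
  "mix_density S \<mu> y = (\<integral>\<theta>. mvn_density \<theta> S y \<partial>\<mu>)"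

text \<open>The integral and its supremum take values in \<open>[0, \<infinity>]\<close>, so that neither integrability nor
  boundedness is presupposed.\<close>

definition L_fun :: "real^'n^'n \<Rightarrow> (real \<Rightarrow> (real^'n) measure) \<Rightarrow> real \<Rightarrow> real^'n \<Rightarrow> ennreal" where
  "L_fun S \<mu> r \<theta> =
     (\<integral>\<^sup>+ y. ennreal ((mvn_density \<theta> S y)\<^sup>2 / mix_density S (\<mu> r) y) \<partial>lborel)"

definition l_fun :: "real^'n^'n \<Rightarrow> (real \<Rightarrow> (real^'n) measure) \<Rightarrow> (real^'n) set \<Rightarrow> real \<Rightarrow> ennreal" where
  "l_fun S \<mu> U r = (SUP \<theta>\<in>U. L_fun S \<mu> r \<theta>)"

end

theory Submission
  imports Defs
begin

text \<open>In the whitened coordinates \<open>y = th + \<Sigma>\<^sup>1\<^sup>/\<^sup>2 z\<close>, \<open>\<theta> = th + \<Sigma>\<^sup>1\<^sup>/\<^sup>2 v\<close>, the covariance becomes the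
  identity and \<open>U_data\<close> the ball \<open>\<parallel>v\<parallel>\<^sup>2 \<le> R\<close> with \<open>R = ln (1 + q / n) > 0\<close>. For Gaussian mixing, completing squares gives
  \<open>L = ((1 + r)\<^sup>2 / (1 + 2 r))\<^bsup>D/2\<^esup> exp (\<parallel>v\<parallel>\<^sup>2 / (1 + 2 r))\<close>, so the supremum is attained at \<open>\<parallel>v\<parallel>\<^sup>2 = R\<close>
  and \<open>l'(0) = -2 R exp R\<close>. For uniform mixing, the mixture is the standard Gaussian density times
  \<open>m z = E exp (z \<bullet> u - \<parallel>u\<parallel>\<^sup>2 / 2)\<close> and \<open>L = exp \<parallel>v\<parallel>\<^sup>2 * E (1 / m Z)\<close> for \<open>Z\<close> standard Gaussian
  around \<open>2 v\<close>. Since \<open>m - 1 = O(r)\<close>, \<open>1 / m\<close> may be replaced by \<open>2 - m\<close> up to \<open>O(r\<^sup>2)\<close>, and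
  \<open>E (m Z) = E exp (2 v \<bullet> u) = 1 + 2 \<kappa> r \<parallel>v\<parallel>\<^sup>2 + O(r\<^sup>2)\<close>, uniformly in \<open>v\<close>; for small \<open>r\<close> the
  resulting bounds increase with \<open>\<parallel>v\<parallel>\<close>, whence \<open>l'(0) = -2 \<kappa> R exp R\<close>.\<close>

subsection \<open>Square roots of positive semidefinite matrices\<close>

text \<open>A maximiser of \<open>x \<bullet> f x\<close> on the unit sphere of \<open>V\<close> is
  an eigenvector: if the residual \<open>w = f x - l x\<close> were nonzero, a small move from
  \<open>x\<close> along \<open>w\<close> would beat the maximum.\<close>

lemma selfadjoint_eigenvector:
  fixes f :: "'a::euclidean_space \<Rightarrow> 'a"
  assumes f: "linear f" and V: "subspace V" "V \<noteq> {0}" "\<And>x. x \<in> V \<Longrightarrow> f x \<in> V"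
    and sa: "\<And>x y. x \<in> V \<Longrightarrow> y \<in> V \<Longrightarrow> f x \<bullet> y = x \<bullet> f y"
  obtains x l where "x \<in> V" "norm x = 1" "f x = l *\<^sub>R x"
proof -
  have lin: "bounded_linear f" using f linear_conv_bounded_linear by blast
  obtain v where v: "v \<in> V" "v \<noteq> 0" using V(1,2) subspace_0 by fastforce
  have "compact (sphere 0 1 \<inter> V)" using V(1) by (intro compact_Int_closed closed_subspace) auto
  moreover have "(1 / norm v) *\<^sub>R v \<in> sphere 0 1 \<inter> V" using v by (simp add: subspace_scale[OF V(1)])
  moreover have "continuous_on (sphere 0 1 \<inter> V) (\<lambda>x. x \<bullet> f x)"
    by (rule continuous_on_inner[OF continuous_on_id linear_continuous_on[OF lin]])
  ultimately obtain x where x: "x \<in> sphere 0 1 \<inter> V" and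
    mx: "\<And>y. y \<in> sphere 0 1 \<inter> V \<Longrightarrow> y \<bullet> f y \<le> x \<bullet> f x"
    using continuous_attains_sup[of "sphere 0 1 \<inter> V" "\<lambda>x. x \<bullet> f x"] by blast
  define l where "l = x \<bullet> f x"
  have le: "y \<bullet> f y \<le> l * (y \<bullet> y)" if "y \<in> V" for y
  proof (cases "y = 0")
    case True then show ?thesis by (simp add: linear_0[OF f])
  next
    case False
    have "(1 / norm y) *\<^sub>R y \<in> sphere 0 1 \<inter> V" using False that by (simp add: subspace_scale[OF V(1)])
    from mx[OF this] have "(y \<bullet> f y) / (norm y)^2 \<le> l"
      by (simp add: linear_scale[OF f] l_def power2_eq_square divide_simps)
    then show ?thesis using False by (simp add: divide_simps power2_norm_eq_inner)
  qed
  have xV: "x \<in> V" and nx: "norm x = 1" using x by auto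
  have xx: "x \<bullet> x = 1" using nx by (simp add: norm_eq_1)
  define w where "w = f x - l *\<^sub>R x"
  have wV: "w \<in> V" unfolding w_def using xV V by (simp add: subspace_diff subspace_scale)
  define a c where "a = w \<bullet> w" and "c = l * (w \<bullet> w) - w \<bullet> f w"
  have c0: "c \<ge> 0" using le[OF wV] by (simp add: c_def)
  have wfx: "w \<bullet> f x = a + l * (w \<bullet> x)" unfolding a_def by (simp add: w_def algebra_simps)
  \<comment> \<open>Maximality at \<open>x + t w\<close>: the gain of order \<open>t\<close> is
    \<open>2 t a\<close>, and the loss is only quadratic in \<open>t\<close>.\<close>
  have quad: "2 * t * a \<le> t^2 * c" for t
  proof -
    have "x + t *\<^sub>R w \<in> V" using xV wV V(1) by (simp add: subspace_add subspace_scale)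
    from le[OF this] have "l + 2 * t * (w \<bullet> f x) + t^2 * (w \<bullet> f w)
        \<le> l * (1 + 2 * t * (w \<bullet> x) + t^2 * (w \<bullet> w))"
      using sa[OF xV wV]
      by (simp add: linear_add[OF f] linear_scale[OF f] inner_add_left inner_add_right l_def xx
          inner_commute[of x w] inner_commute[of "f x"] power2_eq_square algebra_simps)
    then show ?thesis by (simp add: wfx c_def algebra_simps)
  qed
  have "a = 0"
  proof (rule ccontr)
    assume "a \<noteq> 0"
    then have a: "a > 0" by (simp add: a_def)
    \<comment> \<open>A step \<open>t\<close> so small that the linear gain wins; the
      \<open>+ 1\<close> keeps the denominator positive when \<open>c = 0\<close>.\<close>
    have "2 * (a / (c + 1)) * a \<le> (a / (c + 1))^2 * c" by (rule quad)
    also have "\<dots> \<le> (a / (c + 1))^2 * (c + 1)" by (intro mult_left_mono) auto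
    also have "\<dots> = (a / (c + 1)) * a" using c0 by (simp add: power2_eq_square)
    finally have "a / (c + 1) * a \<le> 0" by simp
    then show False using a c0 by (simp add: mult_le_0_iff divide_le_0_iff)
  qed
  then have "f x = l *\<^sub>R x" by (simp add: a_def w_def)
  with xV nx that show thesis by blast
qed

text \<open>Splitting off one eigenvector at a time avoids carrying an orthonormal eigenbasis around.\<close>

lemma psd_sqrt_on_subspace:
  fixes f :: "'a::euclidean_space \<Rightarrow> 'a"
  assumes f: "linear f"
  shows "subspace V \<Longrightarrow> (\<And>x. x \<in> V \<Longrightarrow> f x \<in> V)
    \<Longrightarrow> (\<And>x y. x \<in> V \<Longrightarrow> y \<in> V \<Longrightarrow> f x \<bullet> y = x \<bullet> f y) \<Longrightarrow> (\<And>x. x \<in> V \<Longrightarrow> 0 \<le> x \<bullet> f x)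
    \<Longrightarrow> \<exists>g. linear g \<and> (\<forall>x\<in>V. g x \<in> V \<and> g (g x) = f x \<and> 0 \<le> x \<bullet> g x) \<and>
        (\<forall>x\<in>V. \<forall>y\<in>V. g x \<bullet> y = x \<bullet> g y)"
proof (induction "dim V" arbitrary: V rule: less_induct)
  case less
  note V = less.prems(1) and inv = less.prems(2) and sa = less.prems(3) and psd = less.prems(4)
  show ?case
  proof (cases "V = {0}")
    case True
    then show ?thesis
      by (intro exI[of _ "\<lambda>x. 0"]) (auto simp: linear_0[OF f] intro: linearI)
  next
    case False
    obtain x l where x: "x \<in> V" "norm x = 1" "f x = l *\<^sub>R x"
      using selfadjoint_eigenvector[OF f V False inv sa] by metis
    have xx: "x \<bullet> x = 1" using x by (simp add: norm_eq_1)
    have l: "l \<ge> 0" using psd[OF x(1)] x(3) xx by simp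
    define W where "W = {y \<in> V. x \<bullet> y = 0}"
    have WV: "y \<in> V" "x \<bullet> y = 0" if "y \<in> W" for y using that by (auto simp: W_def)
    have W: "subspace W" using V unfolding W_def subspace_def by (auto simp: inner_add_right)
    have "x \<notin> W" using xx by (auto simp: W_def)
    then have "W \<subset> V" using x(1) WV(1) by blast
    then have dimW: "dim W < dim V" using dim_psubset W V by (metis span_eq_iff)
    have fW: "f y \<in> W" if "y \<in> W" for y
      using sa[OF x(1) WV(1)[OF that]] WV[OF that] x(3) inv by (simp add: W_def)
    have "\<exists>g. linear g \<and> (\<forall>x\<in>W. g x \<in> W \<and> g (g x) = f x \<and> 0 \<le> x \<bullet> g x) \<and>
        (\<forall>x\<in>W. \<forall>y\<in>W. g x \<bullet> y = x \<bullet> g y)"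
      using sa psd WV(1) by (intro less.hyps[OF dimW W fW]) simp_all
    then obtain g where g: "linear g" and gW: "\<And>y. y \<in> W \<Longrightarrow> g y \<in> W"
      and gg: "\<And>y. y \<in> W \<Longrightarrow> g (g y) = f y" and gp: "\<And>y. y \<in> W \<Longrightarrow> 0 \<le> y \<bullet> g y"
      and gs: "\<And>y z. y \<in> W \<Longrightarrow> z \<in> W \<Longrightarrow> g y \<bullet> z = y \<bullet> g z"
      by auto
    define p where "p y = y - (x \<bullet> y) *\<^sub>R x" for y
    have pW: "p y \<in> W" if "y \<in> V" for y
      using that V x(1) xx by (auto simp: p_def W_def subspace_diff subspace_scale inner_diff_right)
    have p: "linear p" by (rule linearI) (auto simp: p_def algebra_simps inner_add_right)
    \<comment> \<open>The root acts as \<open>sqrt l\<close> on the line through \<open>x\<close>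
      and as \<open>g\<close> on \<open>W\<close>, where \<open>p\<close> is the orthogonal
      projection of \<open>V\<close> onto \<open>W\<close>.\<close>
    define h where "h y = (sqrt l * (x \<bullet> y)) *\<^sub>R x + g (p y)" for y
    have h: "linear h"
      by (rule linearI) (auto simp: h_def linear_add[OF p] linear_scale[OF p] linear_add[OF g]
          linear_scale[OF g] algebra_simps inner_add_right)
    have gp0: "x \<bullet> g (p y) = 0" if "y \<in> V" for y using WV(2)[OF gW[OF pW[OF that]]] .
    have split: "y = (x \<bullet> y) *\<^sub>R x + p y" for y by (simp add: p_def)
    have hV: "h y \<in> V" if "y \<in> V" for y
      using gW[OF pW[OF that]] WV(1) x(1) V by (simp add: h_def subspace_add subspace_scale)
    \<comment> \<open>A bilinear form from which both nonnegativity and, through self-adjointness of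
      \<open>g\<close> on \<open>W\<close>, symmetry of \<open>h\<close> are read off.\<close>
    have hin: "h y \<bullet> z = sqrt l * (x \<bullet> y) * (x \<bullet> z) + g (p y) \<bullet> p z" if "y \<in> V" "z \<in> V" for y z
      using gp0[OF that(1)]
      by (simp add: h_def inner_add_left inner_add_right p_def[of z] inner_diff_right inner_commute)
    have "h (h y) = f y" if "y \<in> V" for y
    proof -
      have xh: "x \<bullet> h y = sqrt l * (x \<bullet> y)" using gp0[OF that] xx by (simp add: h_def inner_add_right)
      have "p (h y) = g (p y)" unfolding p_def[of "h y"] xh by (simp add: h_def)
      then have "h (h y) = (l * (x \<bullet> y)) *\<^sub>R x + f (p y)"
        using gg[OF pW[OF that]] xh l by (simp add: h_def[of "h y"])
      also have "\<dots> = f ((x \<bullet> y) *\<^sub>R x + p y)" by (simp add: linear_add[OF f] linear_scale[OF f] x(3))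
      finally show ?thesis using split[of y] by simp
    qed
    moreover have "0 \<le> y \<bullet> h y" if "y \<in> V" for y
      using hin[OF that that] gp[OF pW[OF that]] l by (simp add: inner_commute mult.assoc)
    moreover have "h y \<bullet> z = y \<bullet> h z" if "y \<in> V" "z \<in> V" for y z
      using hin[OF that] hin[OF that(2,1)] gs[OF pW[OF that(1)] pW[OF that(2)]] by (simp add: inner_commute)
    ultimately show ?thesis using h hV by blast
  qed
qed

lemma inner_matrix_vector_transpose:
  fixes A :: "real^'n^'n"
  shows "(A *v x) \<bullet> y = x \<bullet> (transpose A *v y)"
  by (metis dot_lmul_matrix inner_commute transpose_matrix_vector)

lemma pos_semidef_sqrt_exists:
  fixes A :: "real^'n^'n"
  assumes "pos_semidef A"
  shows "\<exists>S. pos_semidef S \<and> S ** S = A"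
proof -
  have A: "transpose A = A" "\<And>x. 0 \<le> x \<bullet> (A *v x)" using assms by (auto simp: pos_semidef_def)
  obtain g where g: "linear g" "\<And>x. g (g x) = A *v x" "\<And>x. 0 \<le> x \<bullet> g x" "\<And>x y. g x \<bullet> y = x \<bullet> g y"
    using psd_sqrt_on_subspace[of "(*v) A" UNIV] A inner_matrix_vector_transpose[of A]
    by (auto simp: subspace_UNIV)
  have gm: "matrix g *v x = g x" for x using g(1) by (simp add: matrix_works)
  have "matrix g ** matrix g = A"
    by (simp add: matrix_eq gm g(2) flip: matrix_vector_mul_assoc)
  moreover have "transpose (matrix g) = matrix g"
  proof -
    have "(transpose (matrix g) *v x) \<bullet> y = (matrix g *v x) \<bullet> y" for x y
      using inner_matrix_vector_transpose[of "transpose (matrix g)" x y] g(4)[of x y] by (simp add: gm)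
    then have "transpose (matrix g) *v x = matrix g *v x" for x
      using vector_eq_rdot by blast
    then show ?thesis by (simp add: matrix_eq)
  qed
  ultimately show ?thesis using g(3) by (auto simp: pos_semidef_def gm)
qed

text \<open>For an eigenvector \<open>x\<close> of \<open>D = S - T\<close> with eigenvalue
  \<open>l\<close>, equality of the squares gives
  \<open>l * (x \<bullet> S x + x \<bullet> T x) = 0\<close>. If \<open>l\<close> is nonzero,
  positivity kills both summands, so \<open>l = x \<bullet> D x = 0\<close> after all.\<close>

lemma pos_semidef_sqrt_unique:
  fixes S T :: "real^'n^'n"
  assumes S: "pos_semidef S" and T: "pos_semidef T" and eq: "S ** S = T ** T"
  shows "S = T"
proof (rule ccontr)
  assume "S \<noteq> T"
  define D where "D = S - T"
  have Dv: "D *v x = S *v x - T *v x" for x by (simp add: D_def matrix_vector_mult_diff_rdistrib)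
  have sS: "(S *v x) \<bullet> y = x \<bullet> (S *v y)" and sT: "(T *v x) \<bullet> y = x \<bullet> (T *v y)" for x y
    using S T inner_matrix_vector_transpose[of S] inner_matrix_vector_transpose[of T]
    by (auto simp: pos_semidef_def)
  have sD: "(D *v x) \<bullet> y = x \<bullet> (D *v y)" for x y
    by (simp add: Dv inner_diff_left inner_diff_right sS sT)
  have lin: "linear ((*v) D)" by simp
  have "\<exists>x. D *v x \<noteq> 0" using \<open>S \<noteq> T\<close> by (auto simp: Dv matrix_eq)
  then have "range ((*v) D) \<noteq> {0}" by auto
  moreover have "subspace (range ((*v) D))" using lin linear_subspace_image subspace_UNIV by blast
  ultimately obtain x l where x: "x \<in> range ((*v) D)" "norm x = 1" "D *v x = l *\<^sub>R x"
    using selfadjoint_eigenvector[OF lin, of "range ((*v) D)"] sD by blast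
  have xx: "x \<bullet> x = 1" using x(2) by (simp add: norm_eq_1)
  \<comment> \<open>The eigenvector was taken in the range of the self-adjoint \<open>D\<close>,
    which is orthogonal to its kernel.\<close>
  have "l \<noteq> 0"
  proof
    assume "l = 0"
    obtain y where "x = D *v y" using x(1) by blast
    then have "x \<bullet> x = y \<bullet> (D *v x)" using sD by simp
    then show False using x(3) \<open>l = 0\<close> xx by simp
  qed
  have "S *v (S *v x) = T *v (T *v x)" using eq by (simp add: matrix_vector_mul_assoc)
  then have "(S *v x) \<bullet> (D *v x) + (D *v x) \<bullet> (T *v x) = 0"
    using sS[of x "S *v x"] sT[of x "T *v x"]
    by (simp add: Dv inner_diff_left inner_diff_right inner_commute)
  then have "l * (x \<bullet> (S *v x) + x \<bullet> (T *v x)) = 0"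
    by (simp add: x(3) inner_commute algebra_simps)
  then have "x \<bullet> (S *v x) + x \<bullet> (T *v x) = 0" using \<open>l \<noteq> 0\<close> by simp
  moreover have "0 \<le> x \<bullet> (S *v x)" "0 \<le> x \<bullet> (T *v x)" using S T by (auto simp: pos_semidef_def)
  ultimately have "x \<bullet> (D *v x) = 0" by (simp add: Dv inner_diff_right)
  then show False using x(3) xx \<open>l \<noteq> 0\<close> by simp
qed

lemma matrix_sqrt:
  assumes "pos_semidef A"
  shows "pos_semidef (matrix_sqrt A)" "matrix_sqrt A ** matrix_sqrt A = A"
proof -
  have "\<exists>!S. pos_semidef S \<and> S ** S = A"
    using pos_semidef_sqrt_exists[OF assms] pos_semidef_sqrt_unique by metis
  from theI'[OF this] show "pos_semidef (matrix_sqrt A)" "matrix_sqrt A ** matrix_sqrt A = A"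
    unfolding matrix_sqrt_def by blast+
qed

lemma pos_def_invertible: "pos_def A \<Longrightarrow> invertible A"
  unfolding pos_def_def invertible_left_inverse matrix_left_invertible_ker
  by (metis inner_zero_right less_irrefl)

lemma pos_def_imp_pos_semidef: "pos_def A \<Longrightarrow> pos_semidef A"
  unfolding pos_def_def pos_semidef_def by (metis inner_zero_left order.strict_implies_order order_refl)

subsection \<open>Linear changes of variables and Gaussian integrals\<close>

lemma matrix_inv_eqI:
  fixes A B :: "real^'n^'n"
  assumes "A ** B = mat 1"
  shows "matrix_inv A = B"
proof -
  have BA: "B ** A = mat 1" using assms matrix_left_right_inverse by blast
  have "A ** matrix_inv A = mat 1 \<and> matrix_inv A ** A = mat 1"
    unfolding matrix_inv_def by (rule someI_ex) (use assms BA in blast)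
  then show ?thesis by (metis BA matrix_mul_assoc matrix_mul_lid matrix_mul_rid)
qed


text \<open>Since \<open>k\<close> is constant along \<open>b\<close>, integrating the
  \<open>b\<close> coordinate innermost turns the shear into a translation of each line parallel to
  \<open>b\<close>.\<close>

lemma nn_integral_lborel_shear:
  fixes f :: "'a::euclidean_space \<Rightarrow> ennreal" and k :: "'a \<Rightarrow> real"
  assumes [measurable]: "f \<in> borel_measurable borel" "k \<in> borel_measurable borel"
    and b: "b \<in> Basis" and k: "\<And>x t. k (x + t *\<^sub>R b) = k x"
  shows "(\<integral>\<^sup>+x. f (x + k x *\<^sub>R b) \<partial>lborel) = (\<integral>\<^sup>+x. f x \<partial>lborel)"
proof -
  interpret product_sigma_finite "\<lambda>_::'a. lborel :: real measure"
    by (simp add: product_sigma_finite_def sigma_finite_lborel)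
  define I where "I = Basis - {b}"
  have I: "finite I" "b \<notin> I" "Basis = insert b I" using b by (auto simp: I_def)
  define y where "y g = (\<Sum>j\<in>I. g j *\<^sub>R j)" for g :: "'a \<Rightarrow> real"
  have split: "(\<integral>\<^sup>+x. h x \<partial>lborel)
      = (\<integral>\<^sup>+g. (\<integral>\<^sup>+t. h (y g + t *\<^sub>R b) \<partial>lborel) \<partial>(Pi\<^sub>M I (\<lambda>_. lborel)))"
    if [measurable]: "h \<in> borel_measurable borel" for h :: "'a \<Rightarrow> ennreal"
  proof -
    have "(\<integral>\<^sup>+x. h x \<partial>lborel) = (\<integral>\<^sup>+g. h (\<Sum>j\<in>Basis. g j *\<^sub>R j) \<partial>(Pi\<^sub>M (insert b I) (\<lambda>_. lborel)))"
      unfolding I(3)[symmetric] by (subst lborel_eq) (simp add: nn_integral_distr)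
    also have "\<dots> = (\<integral>\<^sup>+g. (\<integral>\<^sup>+t. h ((\<lambda>g t. \<Sum>j\<in>Basis. (g(b := t)) j *\<^sub>R j) g t) \<partial>lborel) \<partial>(Pi\<^sub>M I (\<lambda>_. lborel)))"
      by (subst product_nn_integral_insert[OF I(1,2)]) (simp_all add: I(3)[symmetric])
    also have "(\<lambda>g t. \<Sum>j\<in>Basis. (g(b := t)) j *\<^sub>R j) = (\<lambda>g t. y g + t *\<^sub>R b)"
    proof (intro ext)
      fix g :: "'a \<Rightarrow> real" and t
      have "(\<Sum>j\<in>I. (g(b := t)) j *\<^sub>R j) = y g"
        unfolding y_def using I(2) by (intro sum.cong) auto
      moreover have "(\<Sum>j\<in>Basis. (g(b := t)) j *\<^sub>R j) = t *\<^sub>R b + (\<Sum>j\<in>I. (g(b := t)) j *\<^sub>R j)"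
        unfolding I(3) using I(1,2) by simp
      ultimately show "(\<Sum>j\<in>Basis. (g(b := t)) j *\<^sub>R j) = y g + t *\<^sub>R b" by (simp add: add.commute)
    qed
    finally show ?thesis .
  qed
  have "(\<integral>\<^sup>+t. f (y g + t *\<^sub>R b + k (y g + t *\<^sub>R b) *\<^sub>R b) \<partial>lborel) = (\<integral>\<^sup>+t. f (y g + t *\<^sub>R b) \<partial>lborel)" for g
    by (subst nn_integral_real_affine[where c=1 and t="k (y g)" and f="\<lambda>t. f (y g + t *\<^sub>R b)"])
      (simp_all add: k algebra_simps)
  then show ?thesis by (simp add: split)
qed

lemma Basis_real_cart: "(Basis :: (real^'n) set) = range (\<lambda>i. axis i 1)"
  by (auto simp: Basis_vec_def)

lemma inj_axis_1: "inj (\<lambda>i::'n::finite. axis i (1::real))"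
  by (auto simp: inj_on_def axis_eq_axis)

text \<open>Exchanging two coordinates carries boxes to boxes of equal volume, and volumes of boxes
  determine Lebesgue measure.\<close>

lemma nn_integral_lborel_swap:
  fixes f :: "real^'n \<Rightarrow> ennreal"
  assumes [measurable]: "f \<in> borel_measurable borel"
  shows "(\<integral>\<^sup>+x. f (\<chi> i. x $ Transposition.transpose m n i) \<partial>lborel) = (\<integral>\<^sup>+x. f x \<partial>lborel)"
proof -
  define h :: "real^'n \<Rightarrow> real^'n" where "h x = (\<chi> i. x $ Transposition.transpose m n i)" for x
  have h[measurable]: "h \<in> borel_measurable borel"
    unfolding h_def by (intro borel_measurable_continuous_onI continuous_intros)
  have "lborel = distr lborel borel h"
  proof (rule lborel_eqI)
    fix l u :: "real^'n" assume lu: "\<And>b. b \<in> Basis \<Longrightarrow> l \<bullet> b \<le> u \<bullet> b"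
    have prodB: "(\<Prod>b\<in>Basis. (x::real^'n) \<bullet> b) = (\<Prod>i\<in>UNIV. x $ i)" for x
      unfolding Basis_real_cart by (simp add: prod.reindex inj_axis_1 inner_axis)
    have lui: "l $ i \<le> u $ i" for i
      using lu[of "axis i 1"] by (simp add: cart_eq_inner_axis[symmetric] axis_in_Basis_iff)
    have "h -` box l u = box (h l) (h u)"
      unfolding h_def by (auto simp: mem_box_cart) (metis transpose_involutory)+
    moreover have "h l \<bullet> b \<le> h u \<bullet> b" if "b \<in> Basis" for b
      using that lui by (auto simp: Basis_vec_def h_def cart_eq_inner_axis[symmetric])
    ultimately have "emeasure (distr lborel borel h) (box l u) = ennreal (\<Prod>i\<in>UNIV. (h u - h l) $ i)"
      by (simp add: emeasure_distr emeasure_lborel_box_eq prodB del: vector_minus_component)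
    also have "(\<Prod>i\<in>UNIV. (h u - h l) $ i) = (\<Prod>i\<in>UNIV. (u - l) $ i)"
      using prod.permute[OF permutes_swap_id[of m UNIV n], of "\<lambda>i. (u - l) $ i"]
      by (simp add: h_def o_def)
    finally show "emeasure (distr lborel borel h) (box l u) = ennreal (\<Prod>b\<in>Basis. (u - l) \<bullet> b)"
      by (simp add: prodB)
  qed simp
  then have "(\<integral>\<^sup>+x. f x \<partial>lborel) = (\<integral>\<^sup>+x. f x \<partial>distr lborel borel h)" by simp
  also have "\<dots> = (\<integral>\<^sup>+x. f (h x) \<partial>lborel)" by (simp add: nn_integral_distr)
  finally show ?thesis by (simp add: h_def)
qed

lemma borel_measurable_matrix_vector_mult [measurable]:
  fixes A :: "real^'n^'m"
  shows "(*v) A \<in> borel_measurable borel"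
  by (intro borel_measurable_continuous_onI continuous_intros)

text \<open>The change-of-variables results of \<open>HOL-Analysis\<close> require a well-ordered index type,
  hence the detour through elementary matrices.\<close>

lemma nn_integral_lborel_linear:
  fixes A :: "real^'n^'n"
  assumes "det A \<noteq> 0" and "f \<in> borel_measurable borel"
  shows "(\<integral>\<^sup>+y. f y \<partial>lborel) = ennreal \<bar>det A\<bar> * (\<integral>\<^sup>+z. f (A *v z) \<partial>lborel)"
proof -
  have "det A \<noteq> 0 \<longrightarrow> (\<forall>f\<in>borel_measurable borel.
      (\<integral>\<^sup>+y. f y \<partial>lborel) = ennreal \<bar>det A\<bar> * (\<integral>\<^sup>+z. f (A *v z) \<partial>lborel))"
  proof (induction A rule: induct_matrix_elementary)
    case (1 A B)
    show ?case
    proof (intro impI ballI)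
      fix f :: "real^'n \<Rightarrow> ennreal" assume d: "det (A ** B) \<noteq> 0" and [measurable]: "f \<in> borel_measurable borel"
      have dA: "det A \<noteq> 0" and dB: "det B \<noteq> 0" using d by (auto simp: det_mul)
      have m: "(\<lambda>z. f (A *v z)) \<in> borel_measurable borel" by measurable
      have fA: "(\<integral>\<^sup>+y. f y \<partial>lborel) = ennreal \<bar>det A\<bar> * (\<integral>\<^sup>+z. f (A *v z) \<partial>lborel)"
        by (rule bspec[OF mp[OF 1(1) dA]]) measurable
      have fB: "(\<integral>\<^sup>+z. f (A *v z) \<partial>lborel) = ennreal \<bar>det B\<bar> * (\<integral>\<^sup>+z. f (A *v (B *v z)) \<partial>lborel)"
        using bspec[OF mp[OF 1(2) dB] m] .
      show "(\<integral>\<^sup>+y. f y \<partial>lborel) = ennreal \<bar>det (A ** B)\<bar> * (\<integral>\<^sup>+z. f ((A ** B) *v z) \<partial>lborel)"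
        unfolding fA fB by (simp add: det_mul abs_mult ennreal_mult mult.assoc matrix_vector_mul_assoc)
    qed
  next
    \<comment> \<open>A zero row makes the determinant vanish, so the claim is vacuous. This is why
      the determinant condition is an implication inside the induction.\<close>
    case (2 A i)
    then show ?case by (simp add: det_zero_row row_def vec_eq_iff)
  next
    case (3 A)
    show ?case
    proof (intro impI ballI)
      fix f :: "real^'n \<Rightarrow> ennreal" assume d: "det A \<noteq> 0" and [measurable]: "f \<in> borel_measurable borel"
      have dA: "det A = (\<Prod>i\<in>UNIV. A $ i $ i)" using 3 by (simp add: det_diagonal)
      define c where "c b = (A *v b) \<bullet> b" for b
      note B = Basis_real_cart[where 'n='n] and inj = inj_axis_1[where 'n='n]
      have c: "c (axis i 1) = A $ i $ i" for i
        by (simp add: c_def cart_eq_inner_axis[symmetric] matrix_vector_mult_basis column_def)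
      \<comment> \<open>A diagonal matrix written as a coordinatewise scaling with translation
        \<open>0\<close>, the form that \<open>lborel_affine_euclidean\<close> expects.\<close>
      have T: "0 + (\<Sum>j\<in>Basis. (c j * (x \<bullet> j)) *\<^sub>R j) = A *v x" for x
      proof -
        have "(A *v x) $ i = A $ i $ i * x $ i" for i
          unfolding matrix_vector_mult_def using 3
          by (simp, subst sum.remove[of _ i]) (auto intro!: sum.neutral)
        moreover have "(\<Sum>j\<in>Basis. (c j * (x \<bullet> j)) *\<^sub>R j) $ i = A $ i $ i * x $ i" for i
          unfolding B using inj
          by (simp add: sum.reindex c cart_eq_inner_axis[symmetric])
            (subst sum.remove[of _ i], auto simp: axis_def intro!: sum.neutral)
        ultimately show ?thesis by (simp add: vec_eq_iff)
      qed
      have "lborel = density (distr lborel borel ((*v) A)) (\<lambda>_. ennreal (\<Prod>j\<in>Basis. \<bar>c j\<bar>))"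
        unfolding T[symmetric] using d[unfolded dA]
        by (intro lborel_affine_euclidean) (auto simp: B c)
      moreover have "(\<Prod>j\<in>Basis. \<bar>c j\<bar>) = \<bar>det A\<bar>"
        using inj by (simp add: B prod.reindex c dA abs_prod)
      ultimately have "lborel = density (distr lborel borel ((*v) A)) (\<lambda>_. ennreal \<bar>det A\<bar>)" by simp
      then have "(\<integral>\<^sup>+y. f y \<partial>lborel) = (\<integral>\<^sup>+y. f y \<partial>density (distr lborel borel ((*v) A)) (\<lambda>_. ennreal \<bar>det A\<bar>))"
        by simp
      also have "\<dots> = ennreal \<bar>det A\<bar> * (\<integral>\<^sup>+z. f (A *v z) \<partial>lborel)"
        by (simp add: nn_integral_density nn_integral_distr nn_integral_cmult)
      finally show "(\<integral>\<^sup>+y. f y \<partial>lborel) = ennreal \<bar>det A\<bar> * (\<integral>\<^sup>+z. f (A *v z) \<partial>lborel)" .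
    qed
  next
    case (4 m n)
    define A :: "real^'n^'n" where "A = (\<chi> i j. mat 1 $ i $ Transposition.transpose m n j)"
    have "\<bar>det A\<bar> = 1" unfolding A_def
      by (simp add: det_permute_columns permutes_swap_id sign_swap_id abs_mult)
    moreover have "A *v z = (\<chi> i. z $ Transposition.transpose m n i)" for z
    proof -
      have "(A *v z) $ i = z $ Transposition.transpose m n i" for i
      proof -
        have "i = Transposition.transpose m n j \<longleftrightarrow> j = Transposition.transpose m n i" for j
          by (metis transpose_involutory)
        then have "(A *v z) $ i
            = (\<Sum>j\<in>UNIV. if j = Transposition.transpose m n i then z $ Transposition.transpose m n i else 0)"
          unfolding A_def matrix_vector_mult_def mat_def
          by (simp del: sum.delta sum.delta') (rule sum.cong, auto)
        then show ?thesis by simp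
      qed
      then show ?thesis by (simp add: vec_eq_iff)
    qed
    ultimately show ?case unfolding A_def[symmetric] by (simp add: nn_integral_lborel_swap)
  next
    case (5 m n c)
    define A :: "real^'n^'n" where "A = (\<chi> i j. if i = m \<and> j = n then c else of_bool (i = j))"
    have "A = (\<chi> k. if k = m then row m (mat 1) + c *s row n (mat 1) else row k (mat 1))"
      using 5 by (auto simp: A_def vec_eq_iff row_def mat_def)
    then have "det A = 1" using det_row_operation[OF 5, of "mat 1" c] by simp
    \<comment> \<open>The elementary row operation is a shear along \<open>axis m 1\<close>; as
      \<open>m\<close> differs from \<open>n\<close>, the amount \<open>c * z $ n\<close> does not
      vary in that direction.\<close>
    moreover have "A *v z = z + (c * z $ n) *\<^sub>R axis m 1" for z
    proof -
      have "(A *v z) $ i = (z + (c * z $ n) *\<^sub>R axis m 1) $ i" for i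
      proof (cases "i = m")
        case True
        then have "(A *v z) $ i = (\<Sum>j\<in>UNIV. (if j = n then c * z $ n else 0) + (if j = m then z $ m else 0))"
          unfolding A_def matrix_vector_mult_def using 5 by (auto intro!: sum.cong)
        then show ?thesis using True by (simp add: sum.distrib)
      next
        case False
        then have "(A *v z) $ i = (\<Sum>j\<in>UNIV. (if j = i then z $ i else 0))"
          unfolding A_def matrix_vector_mult_def using 5 by (auto intro!: sum.cong)
        then show ?thesis using False by (simp add: axis_def)
      qed
      then show ?thesis by (simp add: vec_eq_iff)
    qed
    moreover have "(\<integral>\<^sup>+x. f (x + (c * x $ n) *\<^sub>R axis m 1) \<partial>lborel) = (\<integral>\<^sup>+x. f x \<partial>lborel)"
      if "f \<in> borel_measurable borel" for f :: "real^'n \<Rightarrow> ennreal"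
      proof (rule nn_integral_lborel_shear[OF that])
      show "c * (x + t *\<^sub>R axis m 1) $ n = c * x $ n" for x t
        using 5 by (simp add: axis_def)
    qed (auto simp: axis_in_Basis_iff)
    ultimately show ?case unfolding A_def[symmetric] by simp
  qed
  then show ?thesis using assms by blast
qed

lemma nn_integral_lborel_translation:
  fixes f :: "'a::euclidean_space \<Rightarrow> ennreal"
  assumes [measurable]: "f \<in> borel_measurable borel"
  shows "(\<integral>\<^sup>+y. f y \<partial>lborel) = (\<integral>\<^sup>+z. f (c + z) \<partial>lborel)"
proof -
  have "lborel = distr lborel borel (\<lambda>x. c + x)"
    using lborel_affine[of 1 c] by (simp add: density_1)
  then have "(\<integral>\<^sup>+y. f y \<partial>lborel) = (\<integral>\<^sup>+y. f y \<partial>distr lborel borel (\<lambda>x. c + x))" by simp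
  then show ?thesis by (simp add: nn_integral_distr)
qed

lemma nn_integral_lborel_affine_matrix:
  fixes A :: "real^'n^'n"
  assumes "det A \<noteq> 0" and [measurable]: "f \<in> borel_measurable borel"
  shows "(\<integral>\<^sup>+y. f y \<partial>lborel) = ennreal \<bar>det A\<bar> * (\<integral>\<^sup>+z. f (c + A *v z) \<partial>lborel)"
  by (subst nn_integral_lborel_translation[of f c], simp)
    (rule nn_integral_lborel_linear[OF assms(1)], simp)

section \<open>Gaussian integrals\<close>

lemma nn_integral_exp_minus_square:
  fixes a b :: real assumes "a > 0"
  shows "(\<integral>\<^sup>+x. ennreal (exp (- a * (x - b)\<^sup>2)) \<partial>lborel) = ennreal (sqrt (pi / a))"
proof -
  \<comment> \<open>The standard deviation for which \<open>1 / (2 * s^2) = a\<close>, so the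
    integrand is a multiple of a normal density.\<close>
  define s where "s = 1 / sqrt (2 * a)"
  have s: "s > 0" "s\<^sup>2 = 1 / (2 * a)" using assms by (auto simp: s_def power_divide)
  have e: "exp (- a * (x - b)\<^sup>2) = sqrt (pi / a) * normal_density b s x" for x
  proof -
    have "2 * pi * s\<^sup>2 = pi / a" using s assms by simp
    moreover have "- (x - b)\<^sup>2 / (2 * s\<^sup>2) = - a * (x - b)\<^sup>2" using s assms by (simp add: field_simps)
    ultimately show ?thesis using assms unfolding normal_density_def by simp
  qed
  have "(\<integral>\<^sup>+x. ennreal (exp (- a * (x - b)\<^sup>2)) \<partial>lborel)
      = ennreal (sqrt (pi / a)) * (\<integral>\<^sup>+x. ennreal (normal_density b s x) \<partial>lborel)"
    unfolding e using assms by (simp add: ennreal_mult nn_integral_cmult)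
  also have "(\<integral>\<^sup>+x. ennreal (normal_density b s x) \<partial>lborel) = 1"
    by (subst nn_integral_eq_integral) (auto simp: s integral_normal_density integrable_normal_density)
  finally show ?thesis by simp
qed

lemma nn_integral_exp_minus_norm_square:
  fixes c :: "'a::euclidean_space" assumes "a > 0"
  shows "(\<integral>\<^sup>+x. ennreal (exp (- a * (norm (x - c))\<^sup>2)) \<partial>lborel) = ennreal (sqrt (pi / a) ^ DIM('a))"
proof -
  have e: "ennreal (exp (- a * (norm (x - c))\<^sup>2)) = (\<Prod>b\<in>Basis. ennreal (exp (- a * (x \<bullet> b - c \<bullet> b)\<^sup>2)))" for x
  proof -
    have "(norm (x - c))\<^sup>2 = (\<Sum>b\<in>Basis. (x \<bullet> b - c \<bullet> b)\<^sup>2)"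
      unfolding power2_norm_eq_inner by (subst euclidean_inner) (simp add: inner_diff_left power2_eq_square)
    then show ?thesis by (simp add: prod_ennreal exp_sum[symmetric] sum_distrib_left)
  qed
  show ?thesis unfolding e
    by (subst nn_integral_lborel_prod)
      (simp_all only: nn_integral_exp_minus_square[OF assms] prod_constant, auto simp: ennreal_power assms less_imp_le)
qed

subsection \<open>The chi-square quantile\<close>

lemma prob_space_chi_square_dist: "prob_space (chi_square_dist k)"
  unfolding chi_square_dist_def
  by (intro prob_space.prob_space_distr prob_space_PiM prob_space_normal_density) auto

text \<open>The sum of squares is almost surely positive, so the distribution function is 0 at 0 and
  by right continuity stays below \<open>p\<close> near 0. Strict positivity makes the radius of the
  uncertainty set nonzero; with radius 0 the derivative would vanish.\<close>

lemma quantile_chi_square_dist_pos: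
  assumes k: "0 < k" and p: "0 < p" "p < 1"
  shows "0 < quantile (chi_square_dist k) p"
proof -
  let ?N = "density lborel (\<lambda>x. ennreal (std_normal_density x))"
  let ?P = "Pi\<^sub>M {..<k} (\<lambda>_. ?N)"
  let ?X = "chi_square_dist k"
  interpret X: real_distribution ?X
    using prob_space_chi_square_dist
    by (simp add: real_distribution_def real_distribution_axioms_def chi_square_dist_def)
  have X[measurable]: "(\<lambda>x. \<Sum>i<k. (x i)\<^sup>2) \<in> borel_measurable ?P" by measurable
  have "AE x in ?N. x \<noteq> 0"
    by (subst AE_density) (auto intro: AE_I[OF _ emeasure_lborel_singleton[of 0]])
  then have "AE x in ?P. x 0 \<noteq> 0"
    using k by (intro AE_PiM_component prob_space_normal_density) auto
  then have "AE x in ?P. 0 < (\<Sum>i<k. (x i)\<^sup>2)"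
  proof (eventually_elim)
    case (elim x)
    have "(x 0)\<^sup>2 \<le> (\<Sum>i<k. (x i)\<^sup>2)" using k by (intro member_le_sum) auto
    moreover have "0 < (x 0)\<^sup>2" using elim by simp
    ultimately show ?case by linarith
  qed
  then have "emeasure ?P {x \<in> space ?P. (\<Sum>i<k. (x i)\<^sup>2) \<le> 0} = 0"
    by (subst (asm) AE_iff_measurable[OF _ refl]) (simp_all only: not_less, measurable)
  then have cdf0: "cdf ?X 0 = 0"
    unfolding cdf_def chi_square_dist_def
    by (subst measure_distr[OF X]) (simp_all add: measure_def vimage_def Int_def conj_commute)
  have "eventually (\<lambda>x. cdf ?X x < p) (at_right 0)"
    using X.cdf_is_right_cont[of 0] p cdf0 unfolding continuous_within
    by (auto dest: order_tendstoD(2))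
  then obtain e where e: "e > 0" "\<And>x. 0 < x \<Longrightarrow> x < e \<Longrightarrow> cdf ?X x < p"
    unfolding eventually_at_right_field by auto
  \<comment> \<open>\<open>Inf\<close> inherits the lower bound \<open>e / 2\<close> only from a
    nonempty set; \<open>p < 1\<close> supplies an element.\<close>
  have "eventually (\<lambda>x. p < cdf ?X x) at_top"
    using X.cdf_lim_at_top_prob p by (auto dest: order_tendstoD(1))
  then obtain x where "p < cdf ?X x" unfolding eventually_at_top_linorder by auto
  then have "{x. p \<le> cdf ?X x} \<noteq> {}" by (auto intro: less_imp_le)
  moreover have "e / 2 \<le> x" if "x \<in> {x. p \<le> cdf ?X x}" for x
  proof (rule ccontr)
    assume "\<not> e / 2 \<le> x"
    then have "cdf ?X x \<le> cdf ?X (e / 2)" by (intro X.cdf_nondecreasing) auto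
    also have "\<dots> < p" using e by auto
    finally show False using that by simp
  qed
  ultimately have "e / 2 \<le> quantile ?X p" unfolding quantile_def by (intro cInf_greatest)
  then show ?thesis using e by simp
qed

subsection \<open>Whitening the Gaussian model\<close>

lemma nn_integral_cmult_ennreal:
  assumes "0 \<le> c" and "f \<in> borel_measurable M"
  shows "(\<integral>\<^sup>+x. ennreal (c * f x) \<partial>M) = ennreal c * (\<integral>\<^sup>+x. ennreal (f x) \<partial>M)"
  using assms by (simp add: ennreal_mult' nn_integral_cmult)

definition std_gauss :: "'a::euclidean_space \<Rightarrow> real" where
  "std_gauss x = exp (- (norm x)\<^sup>2 / 2) / sqrt (2 * pi) ^ DIM('a)"

lemma std_gauss_pos [simp]: "0 < std_gauss x" by (simp add: std_gauss_def)

lemma std_gauss_nonneg [simp]: "0 \<le> std_gauss x" by (simp add: less_imp_le)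

lemma borel_measurable_std_gauss [measurable]: "std_gauss \<in> borel_measurable borel"
  unfolding std_gauss_def by measurable

lemma nn_integral_std_gauss:
  fixes c :: "'a::euclidean_space"
  shows "(\<integral>\<^sup>+x. ennreal (std_gauss (x - c)) \<partial>lborel) = 1"
proof -
  have "(\<integral>\<^sup>+x. ennreal (std_gauss (x - c)) \<partial>lborel)
      = (\<integral>\<^sup>+x. ennreal (1 / sqrt (2 * pi) ^ DIM('a) * exp (- (1/2) * (norm (x - c))\<^sup>2)) \<partial>lborel)"
    by (simp add: std_gauss_def)
  also have "\<dots> = ennreal (1 / sqrt (2 * pi) ^ DIM('a)) * ennreal (sqrt (pi / (1/2)) ^ DIM('a))"
    by (subst nn_integral_cmult_ennreal, simp, simp, subst nn_integral_exp_minus_norm_square) auto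
  also have "\<dots> = 1" by (simp add: mult.commute flip: ennreal_mult)
  finally show ?thesis .
qed

text \<open>Exponential tilting by \<open>u\<close> shifts the mean by \<open>u\<close>. The case
  \<open>a = 0\<close> identifies the density of a mixture, the case \<open>a = 2 v\<close> serves
  to integrate its likelihood ratio.\<close>

lemma std_gauss_mult_exp: "std_gauss (z - a) * exp (z \<bullet> u - (norm u)\<^sup>2 / 2) = exp (a \<bullet> u) * std_gauss (z - (a + u))"
proof -
  have "- (norm (z - a))\<^sup>2 / 2 + (z \<bullet> u - (norm u)\<^sup>2 / 2) = a \<bullet> u + - (norm (z - (a + u)))\<^sup>2 / 2"
    by (simp add: power2_norm_eq_inner inner_diff_left inner_diff_right inner_add_left inner_add_right
        inner_commute field_simps)
  then show ?thesis unfolding std_gauss_def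
    by (simp add: exp_add[symmetric])
qed

text \<open>Completing the square. The chi-square integrand is thus a Gaussian recentred at
  \<open>2 v\<close>, with total mass \<open>exp (norm v ^ 2)\<close>.\<close>

lemma std_gauss_square_quotient: "(std_gauss (z - v))\<^sup>2 / std_gauss z = exp ((norm v)\<^sup>2) * std_gauss (z - 2 *\<^sub>R v)"
proof -
  have "2 * (- (norm (z - v))\<^sup>2 / 2) + (norm z)\<^sup>2 / 2 = (norm v)\<^sup>2 + - (norm (z - 2 *\<^sub>R v))\<^sup>2 / 2"
    by (simp add: power2_norm_eq_inner inner_diff_left inner_diff_right inner_commute field_simps)
  then have "exp (- (norm (z - v))\<^sup>2 / 2) ^ 2 * exp ((norm z)\<^sup>2 / 2)
      = exp ((norm v)\<^sup>2) * exp (- (norm (z - 2 *\<^sub>R v))\<^sup>2 / 2)"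
    by (simp add: exp_add[symmetric] exp_double[symmetric])
  then show ?thesis unfolding std_gauss_def
    by (simp add: power_divide power2_eq_square exp_minus field_simps)
qed

text \<open>Collects the facts about the square root of the covariance on which the coordinates
  \<open>y = th + A z\<close> rest.\<close>

locale whitening =
  fixes Sigma A :: "real^'n^'n" and th :: "real^'n"
  assumes sym: "transpose A = A" and square: "A ** A = Sigma" and det_nz: "det A \<noteq> 0"
begin

lemma det_Sigma: "det Sigma = (det A)\<^sup>2"
  by (simp add: det_mul power2_eq_square flip: square)

lemma whitened_point: obtains v where "\<theta> = th + A *v v"
proof -
  obtain B where "A ** B = mat 1" using det_nz invertible_det_nz invertible_def by blast
  then have "\<theta> = th + A *v (B *v (\<theta> - th))" by (simp add: matrix_vector_mul_assoc)
  then show thesis using that by blast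
qed

text \<open>With \<open>B\<close> the inverse of \<open>A\<close>, the inverse covariance is
  \<open>B ** B / r\<close>, and symmetry of \<open>A\<close> reduces its quadratic form at
  \<open>A w\<close> to \<open>norm w ^ 2 / r\<close>. The scale \<open>r\<close> covers both the
  model density (\<open>r = 1\<close>) and the Gaussian mixing law.\<close>

lemma mvn_density_whitened:
  assumes r: "r > 0"
  shows "mvn_density (th + A *v v) (r *\<^sub>R Sigma) (th + A *v z)
    = exp (- (norm (z - v))\<^sup>2 / (2 * r)) / sqrt (2 * pi * r) ^ CARD('n) / \<bar>det A\<bar>"
proof -
  obtain B where AB: "A ** B = mat 1" and BA: "B ** A = mat 1"
    using det_nz invertible_det_nz invertible_def by blast
  have "(r *\<^sub>R Sigma) ** ((1 / r) *\<^sub>R (B ** B)) = A ** (A ** B) ** B"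
    using r by (simp add: scalar_matrix_assoc matrix_scalar_ac matrix_mul_assoc flip: square)
  then have inv: "matrix_inv (r *\<^sub>R Sigma) = (1 / r) *\<^sub>R (B ** B)"
    by (intro matrix_inv_eqI) (simp add: AB)
  have diff: "th + A *v z - (th + A *v v) = A *v (z - v)" by (simp add: matrix_vector_mult_diff_distrib)
  have "(A *v w) \<bullet> (matrix_inv (r *\<^sub>R Sigma) *v (A *v w)) = (norm w)\<^sup>2 / r" for w
  proof -
    have "(B ** B) *v (A *v w) = B *v w"
      by (simp add: matrix_vector_mul_assoc matrix_mul_assoc[symmetric] BA)
    then have "(A *v w) \<bullet> ((B ** B) *v (A *v w)) = w \<bullet> ((A ** B) *v w)"
      using inner_matrix_vector_transpose[of A w "B *v w"] by (simp add: sym matrix_vector_mul_assoc)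
    then show ?thesis by (simp add: inv AB power2_norm_eq_inner scaleR_matrix_vector_assoc[symmetric])
  qed
  moreover have "sqrt ((2 * pi) ^ CARD('n) * det (r *\<^sub>R Sigma)) = sqrt (2 * pi * r) ^ CARD('n) * \<bar>det A\<bar>"
  proof -
    have "det (r *\<^sub>R Sigma) = r ^ CARD('n) * (det A)\<^sup>2"
      using det_Sigma det_rows_mul[of "\<lambda>_. r" "\<lambda>i. Sigma $ i"]
      by (simp add: scaleR_vec_def vector_scalar_mult_def)
    then have "(2 * pi) ^ CARD('n) * det (r *\<^sub>R Sigma) = (2 * pi * r) ^ CARD('n) * (det A)\<^sup>2"
      by (simp add: power_mult_distrib)
    then show ?thesis by (simp only: real_sqrt_mult real_sqrt_power[of "2 * pi * r"] real_sqrt_abs)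
  qed
  ultimately show ?thesis unfolding mvn_density_def diff by (simp only: divide_divide_eq_left mult.commute[of r] minus_divide_left)
qed

lemma mvn_density_std:
  "mvn_density (th + A *v v) Sigma (th + A *v z) = std_gauss (z - v) / \<bar>det A\<bar>"
  using mvn_density_whitened[of 1 v z] by (simp add: std_gauss_def)

text \<open>As \<open>z \<mapsto> th + A z\<close> is a bijection, knowing \<open>F\<close> along it
  also settles the measurability of \<open>F\<close>.\<close>

lemma nn_integral_whitened:
  assumes f: "f \<in> borel_measurable borel" and F: "\<And>z. F (th + A *v z) = f z"
  shows "F \<in> borel_measurable borel" "(\<integral>\<^sup>+y. F y \<partial>lborel) = ennreal \<bar>det A\<bar> * (\<integral>\<^sup>+z. f z \<partial>lborel)"
proof -
  obtain B where AB: "A ** B = mat 1" using det_nz invertible_det_nz invertible_def by blast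
  have "F y = f (B *v (y - th))" for y
    using F[of "B *v (y - th)"] AB by (simp add: matrix_vector_mul_assoc)
  then have "F = (\<lambda>y. f (B *v (y - th)))" by auto
  then show "F \<in> borel_measurable borel" using f by simp
  then show "(\<integral>\<^sup>+y. F y \<partial>lborel) = ennreal \<bar>det A\<bar> * (\<integral>\<^sup>+z. f z \<partial>lborel)"
    by (subst nn_integral_lborel_affine_matrix[OF det_nz, of F th]) (auto simp: F)
qed

text \<open>The squared numerator brings two factors \<open>1 / \<bar>det A\<bar>\<close>, the
  denominator one, and the change of variables one factor \<open>\<bar>det A\<bar>\<close>; they
  cancel.\<close>

lemma L_fun_whitened:
  assumes q[measurable]: "q \<in> borel_measurable borel"
    and mix: "\<And>z. mix_density Sigma (\<mu> r) (th + A *v z) = q z / \<bar>det A\<bar>"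
  shows "L_fun Sigma \<mu> r (th + A *v v) = (\<integral>\<^sup>+z. ennreal ((std_gauss (z - v))\<^sup>2 / q z) \<partial>lborel)"
proof -
  have "L_fun Sigma \<mu> r (th + A *v v)
      = ennreal \<bar>det A\<bar> * (\<integral>\<^sup>+z. ennreal ((std_gauss (z - v) / \<bar>det A\<bar>)\<^sup>2 / (q z / \<bar>det A\<bar>)) \<partial>lborel)"
    unfolding L_fun_def by (rule nn_integral_whitened) (simp_all add: mix mvn_density_std)
  also have "\<dots> = (\<integral>\<^sup>+z. ennreal (\<bar>det A\<bar> * ((std_gauss (z - v) / \<bar>det A\<bar>)\<^sup>2 / (q z / \<bar>det A\<bar>))) \<partial>lborel)"
    by (rule nn_integral_cmult_ennreal[symmetric]) simp_all
  also have "(\<lambda>z. \<bar>det A\<bar> * ((std_gauss (z - v) / \<bar>det A\<bar>)\<^sup>2 / (q z / \<bar>det A\<bar>))) = (\<lambda>z. (std_gauss (z - v))\<^sup>2 / q z)"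
  proof (rule ext)
    have scale: "c * ((g / c)\<^sup>2 / (x / c)) = g\<^sup>2 / x" if "c \<noteq> 0" for c g x :: real
      using that by (simp add: power2_eq_square)
    show "\<bar>det A\<bar> * ((std_gauss (z - v) / \<bar>det A\<bar>)\<^sup>2 / (q z / \<bar>det A\<bar>)) = (std_gauss (z - v))\<^sup>2 / q z" for z
      by (rule scale) (simp add: det_nz)
  qed
  finally show ?thesis .
qed

lemma mix_density_return:
  "mix_density Sigma (return borel th) (th + A *v z) = std_gauss z / \<bar>det A\<bar>"
proof -
  have "(\<lambda>\<theta>. mvn_density \<theta> Sigma y) \<in> borel_measurable borel" for y
    unfolding mvn_density_def by measurable
  then show ?thesis using mvn_density_std[of 0 z]
    by (simp add: mix_density_def integral_return)
qed

lemma nn_integral_std_gauss_square_quotient: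
  "(\<integral>\<^sup>+z. ennreal ((std_gauss (z - v))\<^sup>2 / std_gauss z) \<partial>lborel) = ennreal (exp ((norm (v::real^'n))\<^sup>2))"
  unfolding std_gauss_square_quotient
  by (simp add: ennreal_mult nn_integral_cmult nn_integral_std_gauss)

lemma L_fun_0:
  assumes "\<mu> 0 = return borel th"
  shows "L_fun Sigma \<mu> 0 (th + A *v v) = ennreal (exp ((norm v)\<^sup>2))"
  using L_fun_whitened[of std_gauss \<mu> 0 v] assms mix_density_return nn_integral_std_gauss_square_quotient
  by simp

section \<open>The chi-square ball in whitened coordinates\<close>

lemma nn_integral_mvn_density:
  "(\<integral>\<^sup>+y. ennreal (mvn_density (th + A *v v) Sigma y) \<partial>lborel) = 1"
proof -
  have "(\<integral>\<^sup>+y. ennreal (mvn_density (th + A *v v) Sigma y) \<partial>lborel)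
     = ennreal \<bar>det A\<bar> * (\<integral>\<^sup>+z. ennreal (std_gauss (z - v) / \<bar>det A\<bar>) \<partial>lborel)"
    by (rule nn_integral_whitened) (simp_all add: mvn_density_std)
  also have "\<dots> = (\<integral>\<^sup>+z. ennreal (\<bar>det A\<bar> * (std_gauss (z - v) / \<bar>det A\<bar>)) \<partial>lborel)"
    by (rule nn_integral_cmult_ennreal[symmetric]) simp_all
  finally show ?thesis using det_nz by (simp add: nn_integral_std_gauss)
qed

text \<open>Expanding the square reduces the divergence to the integral of \<open>p2^2 / p1\<close>
  minus 1, and that integral is \<open>L\<close> for the point mass.\<close>

lemma chi2_divergence_mvn:
  "chi2_divergence (mvn th Sigma) (mvn (th + A *v v) Sigma) = ennreal (exp ((norm v)\<^sup>2) - 1)"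
proof -
  define p1 p2 where "p1 = mvn_density th Sigma" and "p2 = mvn_density (th + A *v v) Sigma"
  have pos: "mvn_density (th + A *v v) Sigma y > 0" for v y
  proof -
    obtain z where "y = th + A *v z" by (rule whitened_point)
    then show ?thesis using mvn_density_std[of v z] det_nz by simp
  qed
  have p[simp]: "p1 y > 0" "p2 y > 0" for y using pos[of 0 y] pos[of v y] by (simp_all add: p1_def p2_def)
  then have p0[simp]: "0 \<le> p1 y" "0 \<le> p2 y" "p1 y \<noteq> 0" for y by (simp_all add: less_imp_le less_imp_neq[symmetric])
  have m[measurable]: "p1 \<in> borel_measurable borel" "p2 \<in> borel_measurable borel"
    unfolding p1_def p2_def mvn_density_def by measurable
  define P1 P2 where "P1 = density lborel (\<lambda>y. ennreal (p1 y))" and "P2 = density lborel (\<lambda>y. ennreal (p2 y))"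
  have dens: "density P1 (\<lambda>y. ennreal (p2 y / p1 y)) = P2"
    unfolding P1_def P2_def by (rule density_density_divide) auto
  have one: "(\<integral>\<^sup>+y. ennreal (p1 y) \<partial>lborel) = 1" "(\<integral>\<^sup>+y. ennreal (p2 y) \<partial>lborel) = 1"
    using nn_integral_mvn_density[of 0] nn_integral_mvn_density[of v] by (simp_all add: p1_def p2_def)
  interpret P1: prob_space P1
    by (rule prob_spaceI) (simp add: P1_def emeasure_density one)
  have m1[measurable]: "(\<lambda>y. ennreal (p2 y / p1 y)) \<in> borel_measurable P1" by (simp add: P1_def)
  have ac: "absolutely_continuous P1 P2"
    unfolding dens[symmetric] by (rule absolutely_continuousI_density) (rule m1)
  \<comment> \<open>The derivative is determined only almost everywhere, which suffices under the
    integral.\<close>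
  have rn: "AE y in P1. ennreal (p2 y / p1 y) = RN_deriv P1 P2 y"
    by (rule P1.RN_deriv_unique[OF m1 dens])
  define X where "X = chi2_divergence P1 P2"
  have "X = (\<integral>\<^sup>+y. ennreal ((p2 y / p1 y - 1)\<^sup>2) \<partial>P1)"
    unfolding X_def chi2_divergence_def using ac rn
    by (auto intro!: nn_integral_cong_AE elim!: eventually_mono simp: eq_commute[of "ennreal _"])
  also have "\<dots> = (\<integral>\<^sup>+y. ennreal (p1 y * (p2 y / p1 y - 1)\<^sup>2) \<partial>lborel)"
    by (simp add: P1_def nn_integral_density ennreal_mult)
  \<comment> \<open>Adding the integral of \<open>2 * p2\<close> moves the negative cross term to
    the other side, so no subtraction in \<open>ennreal\<close> occurs.\<close>
  finally have "X + 2 = (\<integral>\<^sup>+y. ennreal (p1 y * (p2 y / p1 y - 1)\<^sup>2) \<partial>lborel) + (\<integral>\<^sup>+y. 2 * ennreal (p2 y) \<partial>lborel)"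
    by (simp add: nn_integral_cmult one)
  also have "\<dots> = (\<integral>\<^sup>+y. ennreal (p1 y * (p2 y / p1 y - 1)\<^sup>2) + 2 * ennreal (p2 y) \<partial>lborel)"
    by (rule nn_integral_add[symmetric]) auto
  also have "\<dots> = (\<integral>\<^sup>+y. ennreal ((p2 y)\<^sup>2 / p1 y) + ennreal (p1 y) \<partial>lborel)"
  proof (rule nn_integral_cong)
    fix y
    have "p1 y * (p2 y / p1 y - 1)\<^sup>2 + 2 * p2 y = (p2 y)\<^sup>2 / p1 y + p1 y"
      by (simp add: power2_eq_square field_simps)
    then show "ennreal (p1 y * (p2 y / p1 y - 1)\<^sup>2) + 2 * ennreal (p2 y) = ennreal ((p2 y)\<^sup>2 / p1 y) + ennreal (p1 y)"
      by (simp flip: ennreal_plus ennreal_numeral ennreal_mult)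
  qed
  also have "\<dots> = (\<integral>\<^sup>+y. ennreal ((p2 y)\<^sup>2 / p1 y) \<partial>lborel) + 1"
    by (subst nn_integral_add) (auto simp: one)
  also have "(\<integral>\<^sup>+y. ennreal ((p2 y)\<^sup>2 / p1 y) \<partial>lborel) = ennreal (exp ((norm v)\<^sup>2))"
  proof -
    have "mix_density Sigma (return borel th) y = p1 y" for y
      using m(1) unfolding mix_density_def p1_def
      by (subst integral_return) (auto simp: mvn_density_def)
    then show ?thesis
      using L_fun_0[of "\<lambda>_. return borel th" v] by (simp add: L_fun_def p2_def)
  qed
  finally have "X + 2 = ennreal (exp ((norm v)\<^sup>2) + 1)" by simp
  moreover have "ennreal (exp ((norm v)\<^sup>2) + 1) = ennreal (exp ((norm v)\<^sup>2) - 1) + 2"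
    by (subst ennreal_numeral[symmetric], subst ennreal_plus[symmetric]) auto
  ultimately have "X = ennreal (exp ((norm v)\<^sup>2) - 1)" by simp
  then show ?thesis by (simp add: X_def P1_def P2_def p1_def p2_def mvn_def)
qed

text \<open>The divergence \<open>exp (norm v ^ 2) - 1\<close> increases with \<open>norm v\<close>,
  so its sublevel set is a ball; surjectivity of \<open>v \<mapsto> th + A v\<close> turns
  membership into equality of sets.\<close>

lemma U_data_whitened:
  fixes \<alpha> :: real
  defines "q \<equiv> quantile (chi_square_dist CARD('n)) (1 - \<alpha>)"
  assumes "0 < q" and "1 \<le> n"
  shows "U_data th Sigma \<alpha> n = (\<lambda>v. th + A *v v) ` {v. (norm v)\<^sup>2 \<le> ln (1 + q / n)}"
proof -
  have pos: "0 < q / n" using assms by simp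
  have mem: "th + A *v v \<in> U_data th Sigma \<alpha> n \<longleftrightarrow> (norm v)\<^sup>2 \<le> ln (1 + q / n)" for v
  proof -
    have "th + A *v v \<in> U_data th Sigma \<alpha> n \<longleftrightarrow> exp ((norm v)\<^sup>2) - 1 \<le> q / n"
      using pos by (simp add: U_data_def chi2_divergence_mvn q_def ennreal_le_iff)
    also have "\<dots> \<longleftrightarrow> exp ((norm v)\<^sup>2) \<le> 1 + q / n" by linarith
    also have "\<dots> \<longleftrightarrow> (norm v)\<^sup>2 \<le> ln (1 + q / n)" using pos by (subst ln_ge_iff) auto
    finally show ?thesis .
  qed
  show ?thesis
  proof (intro set_eqI)
    fix \<theta>
    obtain v where v: "\<theta> = th + A *v v" by (rule whitened_point)
    show "\<theta> \<in> U_data th Sigma \<alpha> n \<longleftrightarrow> \<theta> \<in> (\<lambda>v. th + A *v v) ` {v. (norm v)\<^sup>2 \<le> ln (1 + q / n)}"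
      using mem unfolding v by (metis (mono_tags, lifting) imageE imageI mem_Collect_eq)
  qed
qed

end

lemma whitening_matrix_sqrt:
  fixes Sigma :: "real^'n^'n"
  assumes "pos_def Sigma"
  shows "whitening Sigma (matrix_sqrt Sigma)"
proof
  have psd: "pos_semidef Sigma" using assms by (rule pos_def_imp_pos_semidef)
  show "transpose (matrix_sqrt Sigma) = matrix_sqrt Sigma"
    using matrix_sqrt(1)[OF psd] by (simp add: pos_semidef_def)
  show sq: "matrix_sqrt Sigma ** matrix_sqrt Sigma = Sigma" using matrix_sqrt(2)[OF psd] .
  have "det Sigma \<noteq> 0" using pos_def_invertible[OF assms] by (simp add: invertible_det_nz)
  then show "det (matrix_sqrt Sigma) \<noteq> 0" using det_mul[of "matrix_sqrt Sigma" "matrix_sqrt Sigma"] sq by auto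
qed

subsection \<open>Gaussian mixing\<close>

lemma norm_diff_scaleR_square:
  "(norm (x - s *\<^sub>R y))\<^sup>2 = (norm x)\<^sup>2 - 2 * s * (x \<bullet> y) + s\<^sup>2 * (norm y)\<^sup>2"
  by (simp only: power2_norm_eq_inner)
    (simp add: inner_diff_left inner_diff_right inner_commute[of y x] power2_eq_square algebra_simps)

text \<open>Completing the square in \<open>u\<close> isolates a factor free of \<open>u\<close>:
  the exponent behind the convolution of variances \<open>r\<close> and \<open>1\<close> giving
  variance \<open>1 + r\<close>.\<close>

lemma exp_minus_norm_square_conv:
  fixes u z :: "'a::real_inner"
  assumes "r > 0"
  shows "exp (- (norm u)\<^sup>2 / (2 * r)) * exp (- (norm (z - u))\<^sup>2 / 2)
    = exp (- (norm z)\<^sup>2 / (2 * (1 + r))) * exp (- ((1 + r) / (2 * r)) * (norm (u - (r / (1 + r)) *\<^sub>R z))\<^sup>2)"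
proof -
  \<comment> \<open>With the inner products named, the claim about exponents is an identity of
    rational functions.\<close>
  define N P Q where "N = (norm u)\<^sup>2" and "P = (norm z)\<^sup>2" and "Q = u \<bullet> z"
  have "- N / (2 * r) + - (P - 2 * Q + N) / 2
      = - P / (2 * (1 + r)) + - ((1 + r) / (2 * r)) * (N - 2 * (r / (1 + r)) * Q + (r / (1 + r))\<^sup>2 * P)"
    using assms by (simp add: divide_simps power2_eq_square) (simp add: algebra_simps)
  moreover have "(norm (z - u))\<^sup>2 = P - 2 * Q + N"
    using norm_diff_scaleR_square[of z 1 u] by (simp add: N_def P_def Q_def inner_commute)
  moreover have "(norm (u - (r / (1 + r)) *\<^sub>R z))\<^sup>2 = N - 2 * (r / (1 + r)) * Q + (r / (1 + r))\<^sup>2 * P"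
    unfolding norm_diff_scaleR_square N_def P_def Q_def ..
  ultimately show ?thesis
    by (simp only: exp_add[symmetric] N_def[symmetric] P_def[symmetric])
qed

context whitening
begin

lemma mix_density_mvn:
  assumes r: "r > 0"
  shows "mix_density Sigma (mvn th (r *\<^sub>R Sigma)) (th + A *v z)
    = (exp (- (norm z)\<^sup>2 / (2 * (1 + r))) / sqrt (2 * pi * (1 + r)) ^ CARD('n)) / \<bar>det A\<bar>"
proof -
  define y where "y = th + A *v z"
  define d where "d = \<bar>det A\<bar>"
  have d: "d > 0" using det_nz by (simp add: d_def)
  define F where "F \<theta> = mvn_density th (r *\<^sub>R Sigma) \<theta> * mvn_density \<theta> Sigma y" for \<theta>
  have m: "(\<lambda>\<theta>. mvn_density \<theta> Sigma y) \<in> borel_measurable borel"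
    unfolding mvn_density_def by measurable
  have m'[measurable]: "mvn_density th (r *\<^sub>R Sigma) \<in> borel_measurable borel"
    unfolding mvn_density_def by measurable
  have pos: "0 \<le> mvn_density (th + A *v v) (s *\<^sub>R Sigma) x" if "s > 0" for v s x
  proof -
    obtain w where "x = th + A *v w" by (rule whitened_point)
    then show ?thesis using mvn_density_whitened[OF that, of v w] that by simp
  qed
  have pos1: "0 \<le> mvn_density th (r *\<^sub>R Sigma) x" for x using pos[of r 0] r by simp
  have pos2: "0 \<le> mvn_density \<theta> Sigma x" for x \<theta>
  proof -
    obtain w where "\<theta> = th + A *v w" by (rule whitened_point)
    then show ?thesis using pos[of 1 w x] by simp
  qed
  \<comment> \<open>Everything in the joint density that does not depend on the integration variable
    \<open>u\<close>.\<close>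
  define c where "c = exp (- (norm z)\<^sup>2 / (2 * (1 + r))) / (sqrt (2 * pi * r) ^ CARD('n) * sqrt (2 * pi) ^ CARD('n)) / d\<^sup>2"
  have c: "c \<ge> 0" using d r by (simp add: c_def)
  have F: "F (th + A *v u) = c * exp (- ((1 + r) / (2 * r)) * (norm (u - (r / (1 + r)) *\<^sub>R z))\<^sup>2)" for u
  proof -
    have "F (th + A *v u) = (exp (- (norm u)\<^sup>2 / (2 * r)) * exp (- (norm (z - u))\<^sup>2 / 2))
        / (sqrt (2 * pi * r) ^ CARD('n) * sqrt (2 * pi) ^ CARD('n)) / d\<^sup>2"
      using mvn_density_whitened[OF r, of 0 u] mvn_density_std[of u z]
      by (simp add: F_def y_def std_gauss_def d_def power2_eq_square)
    then show ?thesis unfolding exp_minus_norm_square_conv[OF r] c_def by simp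
  qed
  have "(\<integral>\<^sup>+\<theta>. ennreal (mvn_density \<theta> Sigma y) \<partial>mvn th (r *\<^sub>R Sigma)) = (\<integral>\<^sup>+\<theta>. ennreal (F \<theta>) \<partial>lborel)"
    unfolding mvn_def using m pos1 by (subst nn_integral_density) (simp_all add: F_def ennreal_mult')
  also have "\<dots> = ennreal \<bar>det A\<bar> * (\<integral>\<^sup>+u. ennreal (c * exp (- ((1 + r) / (2 * r)) * (norm (u - (r / (1 + r)) *\<^sub>R z))\<^sup>2)) \<partial>lborel)"
    by (rule nn_integral_whitened) (simp_all only: F, measurable)
  also have "\<dots> = ennreal d * (ennreal c * ennreal (sqrt (pi / ((1 + r) / (2 * r))) ^ CARD('n)))"
    using c r by (subst nn_integral_cmult_ennreal, simp, simp, subst nn_integral_exp_minus_norm_square)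
      (auto simp: d_def)
  also have "\<dots> = ennreal (d * c * sqrt (pi / ((1 + r) / (2 * r))) ^ CARD('n))"
    using c d r by (simp add: ennreal_mult mult.assoc)
  finally have "mix_density Sigma (mvn th (r *\<^sub>R Sigma)) y = d * c * sqrt (pi / ((1 + r) / (2 * r))) ^ CARD('n)"
    unfolding mix_density_def using m pos2 c d r
    by (subst integral_eq_nn_integral) (auto simp: mvn_def)
  also have "\<dots> = exp (- (norm z)\<^sup>2 / (2 * (1 + r)))
      * (sqrt (pi / ((1 + r) / (2 * r))) / (sqrt (2 * pi * r) * sqrt (2 * pi))) ^ CARD('n) / d"
    using d by (simp add: c_def power2_eq_square power_divide power_mult_distrib)
  \<comment> \<open>Coordinate by coordinate, the constants combine to the normalisation of variance
    \<open>1 + r\<close>.\<close>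
  also have "sqrt (pi / ((1 + r) / (2 * r))) / (sqrt (2 * pi * r) * sqrt (2 * pi)) = 1 / sqrt (2 * pi * (1 + r))"
  proof -
    have "pi / ((1 + r) / (2 * r)) / (2 * pi * r * (2 * pi)) = 1 / (2 * pi * (1 + r))"
      using r by (simp add: divide_simps)
    then have "sqrt (pi / ((1 + r) / (2 * r)) / (2 * pi * r * (2 * pi))) = sqrt (1 / (2 * pi * (1 + r)))"
      by (rule arg_cong)
    then show ?thesis by (simp only: real_sqrt_divide real_sqrt_mult real_sqrt_one)
  qed
  finally show ?thesis by (simp add: y_def d_def power_divide)
qed

text \<open>A squared unit-variance Gaussian divided by one of variance \<open>1 + r\<close> is
  again an unnormalised Gaussian, so the integral is explicit. At \<open>r = 0\<close>, where the
  law is a point mass by definition, the formula agrees with \<open>L_fun_0\<close>.\<close>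

lemma L_fun_gauss:
  assumes r: "0 \<le> r"
  shows "L_fun Sigma (mu_gauss th Sigma) r (th + A *v v)
    = ennreal (((1 + r) / sqrt (1 + 2 * r)) ^ CARD('n) * exp ((norm v)\<^sup>2 / (1 + 2 * r)))"
proof (cases "r = 0")
  case True
  then show ?thesis using L_fun_0[of "mu_gauss th Sigma" v] by (simp add: mu_gauss_def)
next
  case False
  then have r: "r > 0" using assms by simp
  define q where "q z = exp (- (norm z)\<^sup>2 / (2 * (1 + r))) / sqrt (2 * pi * (1 + r)) ^ CARD('n)" for z :: "real^'n"
  \<comment> \<open>\<open>a = 1 - 1 / (2 * (1 + r))\<close> is minus the coefficient of
    \<open>norm z ^ 2\<close> in the exponent of the quotient.\<close>
  define a where "a = (1 + 2 * r) / (2 * (1 + r))"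
  have a: "a > 0" using r by (simp add: a_def)
  define c where "c = exp ((norm v)\<^sup>2 / (1 + 2 * r)) * sqrt (2 * pi * (1 + r)) ^ CARD('n) / (sqrt (2 * pi) ^ CARD('n))\<^sup>2"
  have c: "c \<ge> 0" using r by (simp add: c_def)
  have quot: "(std_gauss (z - v))\<^sup>2 / q z = c * exp (- a * (norm (z - (1 / a) *\<^sub>R v))\<^sup>2)" for z
  proof -
    define N P Q where "N = (norm v)\<^sup>2" and "P = (norm z)\<^sup>2" and "Q = z \<bullet> v"
    have "2 * (- (P - 2 * Q + N) / 2) + P / (2 * (1 + r)) = N / (1 + 2 * r) + - a * (P - 2 * (1 / a) * Q + (1 / a)\<^sup>2 * N)"
      using r a unfolding a_def by (simp add: divide_simps power2_eq_square) (simp add: algebra_simps)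
    moreover have "(norm (z - v))\<^sup>2 = P - 2 * Q + N"
      using norm_diff_scaleR_square[of z 1 v] by (simp add: N_def P_def Q_def)
    moreover have "(norm (z - (1 / a) *\<^sub>R v))\<^sup>2 = P - 2 * (1 / a) * Q + (1 / a)\<^sup>2 * N"
      unfolding norm_diff_scaleR_square N_def P_def Q_def ..
    ultimately have "2 * (- (norm (z - v))\<^sup>2 / 2) + (norm z)\<^sup>2 / (2 * (1 + r))
        = (norm v)\<^sup>2 / (1 + 2 * r) + - a * (norm (z - (1 / a) *\<^sub>R v))\<^sup>2"
      by (simp only: N_def[symmetric] P_def[symmetric])
    then have "exp (- (norm (z - v))\<^sup>2 / 2) ^ 2 * exp ((norm z)\<^sup>2 / (2 * (1 + r)))
        = exp ((norm v)\<^sup>2 / (1 + 2 * r)) * exp (- a * (norm (z - (1 / a) *\<^sub>R v))\<^sup>2)"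
      by (simp only: exp_add[symmetric] exp_double[symmetric])
    then show ?thesis using r unfolding std_gauss_def q_def c_def
      by (simp add: power_divide exp_minus field_simps)
  qed
  have "L_fun Sigma (mu_gauss th Sigma) r (th + A *v v) = (\<integral>\<^sup>+z. ennreal ((std_gauss (z - v))\<^sup>2 / q z) \<partial>lborel)"
  proof (rule L_fun_whitened)
    show "q \<in> borel_measurable borel" unfolding q_def by measurable
    show "mix_density Sigma (mu_gauss th Sigma r) (th + A *v z) = q z / \<bar>det A\<bar>" for z
      using r mix_density_mvn[OF r] by (simp add: mu_gauss_def q_def)
  qed
  also have "\<dots> = ennreal (c * sqrt (pi / a) ^ CARD('n))"
    unfolding quot using c a
    by (subst nn_integral_cmult_ennreal, simp, simp, subst nn_integral_exp_minus_norm_square)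
      (auto simp: ennreal_mult)
  also have "c * sqrt (pi / a) ^ CARD('n) = ((1 + r) / sqrt (1 + 2 * r)) ^ CARD('n) * exp ((norm v)\<^sup>2 / (1 + 2 * r))"
  proof -
    have "sqrt (2 * pi * (1 + r)) * sqrt (pi / a) / (sqrt (2 * pi))\<^sup>2 = (1 + r) / sqrt (1 + 2 * r)"
    proof -
      have "2 * pi * (1 + r) * (pi / a) = (2 * pi * (1 + r))\<^sup>2 / (1 + 2 * r)"
        using r by (simp add: a_def power2_eq_square)
      then have "sqrt (2 * pi * (1 + r) * (pi / a)) = sqrt ((2 * pi * (1 + r))\<^sup>2 / (1 + 2 * r))"
        by (rule arg_cong)
      also have "\<dots> = \<bar>2 * pi * (1 + r)\<bar> / sqrt (1 + 2 * r)"
        by (simp only: real_sqrt_divide real_sqrt_abs)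
      finally have "sqrt (2 * pi * (1 + r)) * sqrt (pi / a) = 2 * pi * (1 + r) / sqrt (1 + 2 * r)"
        using r by (simp only: real_sqrt_mult abs_mult) simp
      then show ?thesis by simp
    qed
    then have "((1 + r) / sqrt (1 + 2 * r)) ^ CARD('n)
      = (sqrt (2 * pi * (1 + r)) * sqrt (pi / a) / (sqrt (2 * pi))\<^sup>2) ^ CARD('n)"
      by simp
    also have "\<dots> = sqrt (2 * pi * (1 + r)) ^ CARD('n) * sqrt (pi / a) ^ CARD('n) / (sqrt (2 * pi) ^ CARD('n))\<^sup>2"
      by (simp only: power_divide power_mult_distrib power_mult[symmetric] mult.commute)
    finally have "((1 + r) / sqrt (1 + 2 * r)) ^ CARD('n)
      = sqrt (2 * pi * (1 + r)) ^ CARD('n) * sqrt (pi / a) ^ CARD('n) / (sqrt (2 * pi) ^ CARD('n))\<^sup>2" .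
    then show ?thesis by (simp add: c_def)
  qed
  finally show ?thesis .
qed

end

subsection \<open>Uniform distributions on balls\<close>

text \<open>Both volumes in the quotient defining a uniform measure scale by
  \<open>\<bar>det M\<bar>\<close>. Applied below to the reflection and to scaled rotations of
  balls.\<close>

lemma uniform_measure_matrix_image:
  fixes M :: "real^'n^'n"
  assumes M: "det M \<noteq> 0" and [measurable]: "S \<in> sets borel" "T \<in> sets borel"
    and ST: "\<And>z. M *v z \<in> S \<longleftrightarrow> z \<in> T"
  shows "uniform_measure lborel S = distr (uniform_measure lborel T) borel ((*v) M)"
proof (rule measure_eqI)
  fix X assume "X \<in> sets (uniform_measure lborel S)"
  then have [measurable]: "X \<in> sets borel" by simp
  have em: "emeasure lborel (S \<inter> Y) = ennreal \<bar>det M\<bar> * emeasure lborel (T \<inter> (*v) M -` Y)"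
    if [measurable]: "Y \<in> sets borel" for Y
  proof -
    have [measurable]: "(*v) M -` Y \<in> sets borel"
      using measurable_sets_borel[OF borel_measurable_matrix_vector_mult that] .
    have "indicator (S \<inter> Y) (M *v z) = (indicator (T \<inter> (*v) M -` Y) z :: ennreal)" for z
      using ST by (simp add: indicator_def)
    then show ?thesis
      using nn_integral_lborel_linear[OF M, of "indicator (S \<inter> Y)"] by (simp add: nn_integral_indicator)
  qed
  have MX: "(*v) M -` X \<in> sets borel"
    using measurable_sets_borel[OF borel_measurable_matrix_vector_mult \<open>X \<in> sets borel\<close>] .
  have S: "emeasure lborel S = ennreal \<bar>det M\<bar> * emeasure lborel T"
    using em[of UNIV] by simp
  have "emeasure (distr (uniform_measure lborel T) borel ((*v) M)) X
      = emeasure lborel (T \<inter> (*v) M -` X) / emeasure lborel T"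
    using MX by (simp add: emeasure_distr measurable_cong_sets[OF sets_uniform_measure refl])
  also have "\<dots> = emeasure lborel (S \<inter> X) / emeasure lborel S"
    unfolding em[OF \<open>X \<in> sets borel\<close>] S using M
    by (subst (1 2) mult.commute[of "ennreal \<bar>det M\<bar>"], subst divide_mult_eq) (simp_all add: ennreal_eq_0_iff)
  finally show "emeasure (uniform_measure lborel S) X = emeasure (distr (uniform_measure lborel T) borel ((*v) M)) X"
    by simp
qed simp

lemma prob_space_uniform_cball:
  assumes "0 < s"
  shows "prob_space (uniform_measure lborel (cball (0::'a::euclidean_space) s))"
proof (rule prob_space_uniform_measure)
  have "ball (0::'a) s \<subseteq> cball 0 s" by auto
  then have "emeasure lborel (ball (0::'a) s) \<le> emeasure lborel (cball (0::'a) s)"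
    by (rule emeasure_mono) simp
  moreover have "emeasure lborel (ball (0::'a) s) > 0"
    using assms by (simp add: emeasure_ball)
  ultimately show "emeasure lborel (cball (0::'a) s) \<noteq> 0" by auto
  show "emeasure lborel (cball (0::'a) s) \<noteq> \<infinity>"
    using emeasure_lborel_cball_finite[of "0::'a" s] by simp
qed

lemma uniform_cball_symmetric:
  "distr (uniform_measure lborel (cball 0 s)) borel uminus = uniform_measure lborel (cball (0::real^'n) s)"
proof -
  have u: "(- mat 1) *v z = - z" for z :: "real^'n" by (simp add: vec_eq_iff matrix_vector_mult_def mat_def sum_negf if_distrib if_distribR cong: if_cong)
  have "det (- mat 1 :: real^'n^'n) \<noteq> 0"
    by (simp add: invertible_det_nz[symmetric] invertible_def)
      (rule exI[of _ "- mat 1"], simp add: matrix_eq u flip: matrix_vector_mul_assoc)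
  then have "uniform_measure lborel (cball (0::real^'n) s)
      = distr (uniform_measure lborel (cball 0 s)) borel ((*v) (- mat 1))"
    by (rule uniform_measure_matrix_image) (simp_all add: u)
  moreover have "((*v) (- mat 1)) = (uminus :: real^'n \<Rightarrow> real^'n)" using u by auto
  ultimately show ?thesis by simp
qed

text \<open>Scaling and rotation reduce every radius and direction to the second moment of one
  coordinate on the unit ball. Only its positivity decides the sign of the derivative, so the value
  (classically \<open>1 / (D + 2)\<close>) stays abstract.\<close>

lemma uniform_cball_second_moment:
  obtains \<kappa> :: real where "0 < \<kappa>"
    "\<And>s v. 0 < s \<Longrightarrow> (\<integral>u. (v \<bullet> u)\<^sup>2 \<partial>uniform_measure lborel (cball (0::real^'n) s)) = \<kappa> * s\<^sup>2 * (norm v)\<^sup>2"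
proof -
  let ?U = "\<lambda>s. uniform_measure lborel (cball (0::real^'n) s)"
  obtain e :: "real^'n" where e: "norm e = 1" using vector_choose_size[of 1] by auto
  define \<kappa> where "\<kappa> = (\<integral>u. (e \<bullet> u)\<^sup>2 \<partial>?U 1)"
  interpret U: prob_space "?U 1" by (rule prob_space_uniform_cball) simp
  have fin: "emeasure lborel (cball (0::real^'n) 1) < \<infinity>" using emeasure_lborel_cball_finite .
  have nz: "emeasure lborel (cball (0::real^'n) 1) \<noteq> 0"
    using U.emeasure_space_1 by (auto simp: emeasure_uniform_measure divide_ennreal_def)
  have "0 < \<kappa>"
  proof -
    have int: "integrable (?U 1) (\<lambda>u. (e \<bullet> u)\<^sup>2)"
    proof (rule U.integrable_const_bound[of _ 1])
      show "AE u in ?U 1. norm ((e \<bullet> u)\<^sup>2) \<le> 1"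
      proof (rule AE_uniform_measureI)
        show "AE u in lborel. u \<in> cball 0 1 \<longrightarrow> norm ((e \<bullet> u)\<^sup>2) \<le> 1"
        proof (intro AE_I2 impI)
          fix u :: "real^'n" assume "u \<in> cball 0 1"
          then have "\<bar>e \<bullet> u\<bar> \<le> 1" using Cauchy_Schwarz_ineq2[of e u] e by simp
          then show "norm ((e \<bullet> u)\<^sup>2) \<le> 1" by (simp add: abs_square_le_1)
        qed
      qed simp
    qed simp
    have "\<kappa> \<noteq> 0"
    proof
      assume "\<kappa> = 0"
      then have "AE u in ?U 1. (e \<bullet> u)\<^sup>2 = 0"
        unfolding \<kappa>_def using integral_nonneg_eq_0_iff_AE[OF int] by simp
      then have "AE u in lborel. u \<in> cball 0 1 \<longrightarrow> e \<bullet> u = 0"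
        using nz fin by (subst (asm) AE_uniform_measure) auto
      \<comment> \<open>The small ball around \<open>e / 2\<close> lies in the unit ball and misses
        the hyperplane orthogonal to \<open>e\<close>, so \<open>\<kappa> = 0\<close> would make it
        a null set.\<close>
      then have "AE u in lborel. u \<notin> ball ((1/2) *\<^sub>R e) (1/2)"
      proof eventually_elim
        case (elim u)
        show ?case
        proof
          assume "u \<in> ball ((1/2) *\<^sub>R e) (1/2)"
          then have d: "norm ((1/2) *\<^sub>R e - u) < 1/2" by (simp add: dist_norm)
          have "norm u \<le> norm ((1/2) *\<^sub>R e) + norm ((1/2) *\<^sub>R e - u)"
            by (metis norm_minus_commute norm_triangle_sub)
          then have "norm u \<le> 1" using d e by simp
          then have "e \<bullet> u = 0" using elim by simp
          then have "e \<bullet> ((1/2) *\<^sub>R e - u) = 1/2" using e by (simp add: inner_diff_right norm_eq_1)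
          moreover have "e \<bullet> ((1/2) *\<^sub>R e - u) \<le> norm ((1/2) *\<^sub>R e - u)"
            using norm_cauchy_schwarz[of e "(1/2) *\<^sub>R e - u"] e by simp
          ultimately show False using d by simp
        qed
      qed
      then have "emeasure lborel {u \<in> space lborel. \<not> u \<notin> ball ((1/2) *\<^sub>R e) (1/2)} = 0"
        by (subst (asm) AE_iff_measurable[OF _ refl]) auto
      moreover have "{u \<in> space lborel. \<not> u \<notin> ball ((1/2) *\<^sub>R e) (1/2)} = ball ((1/2) *\<^sub>R e) (1/2)" by auto
      ultimately have "emeasure lborel (ball ((1/2) *\<^sub>R e) (1/2)) = 0" by (simp only:)
      moreover have "emeasure lborel (ball ((1/2) *\<^sub>R e) (1/2)) > 0"
        by (simp add: emeasure_ball)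
      ultimately show False by simp
    qed
    moreover have "\<kappa> \<ge> 0" unfolding \<kappa>_def by simp
    ultimately show ?thesis by simp
  qed
  moreover have "(\<integral>u. (v \<bullet> u)\<^sup>2 \<partial>?U s) = \<kappa> * s\<^sup>2 * (norm v)\<^sup>2" if s: "0 < s" for s v
  proof (cases "v = 0")
    case False
    define w where "w = (1 / norm v) *\<^sub>R v"
    have w: "norm w = 1" "v = norm v *\<^sub>R w" using False by (auto simp: w_def)
    obtain f where f: "orthogonal_transformation f" "f e = w"
      using orthogonal_transformation_exists_1[OF e w(1)] .
    have lin: "linear f" using f(1) by (rule orthogonal_transformation_linear)
    \<comment> \<open>A rotation taking \<open>e\<close> to the direction of \<open>v\<close>,
      scaled by \<open>s\<close>, maps the unit ball onto the ball of radius
      \<open>s\<close>.\<close>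
    define M where "M = s *\<^sub>R matrix f"
    have Mu: "M *v u = s *\<^sub>R f u" for u
      using matrix_works[of f u] lin by (simp add: M_def scaleR_matrix_vector_assoc[symmetric])
    have "inj ((*v) M)"
      using orthogonal_transformation_inj[OF f(1)] s by (auto simp: inj_on_def Mu)
    then have "det M \<noteq> 0" using det_nz_iff_inj[of "(*v) M"] by simp
    then have "?U s = distr (?U 1) borel ((*v) M)"
      using s by (rule_tac uniform_measure_matrix_image)
        (auto simp: Mu orthogonal_transformation_norm[OF f(1)])
    then have "(\<integral>u. (v \<bullet> u)\<^sup>2 \<partial>?U s) = (\<integral>u. (v \<bullet> (M *v u))\<^sup>2 \<partial>?U 1)"
      by (simp add: integral_distr measurable_cong_sets[OF sets_uniform_measure refl])
    also have "(\<lambda>u. (v \<bullet> (M *v u))\<^sup>2) = (\<lambda>u. (s\<^sup>2 * (norm v)\<^sup>2) * (e \<bullet> u)\<^sup>2)"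
    proof (rule ext)
      fix u
      have "v \<bullet> (M *v u) = s * norm v * (f e \<bullet> f u)"
        by (subst w(2)) (simp add: Mu f(2))
      also have "f e \<bullet> f u = e \<bullet> u" using f(1) by (simp add: orthogonal_transformation_def)
      finally show "(v \<bullet> (M *v u))\<^sup>2 = (s\<^sup>2 * (norm v)\<^sup>2) * (e \<bullet> u)\<^sup>2"
        by (simp add: power_mult_distrib)
    qed
    finally show ?thesis by (simp add: \<kappa>_def)
  qed simp
  ultimately show thesis by (rule that)
qed

subsection \<open>Mixing with a small symmetric law\<close>

text \<open>Taylor's formula with Lagrange remainder for \<open>exp\<close> at \<open>x\<close> and
  \<open>-x\<close>; in the average the odd terms cancel.\<close>

lemma cosh_bounds:
  fixes x :: real
  shows "1 + x\<^sup>2 / 2 \<le> cosh x" "cosh x \<le> 1 + x\<^sup>2 / 2 + x ^ 4 / 24 * exp \<bar>x\<bar>" "cosh x \<le> 1 + x\<^sup>2 / 2 * exp \<bar>x\<bar>"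
proof -
  have e2: "exp y \<le> 1 + y + y\<^sup>2 / 2 * exp \<bar>x\<bar>" if "\<bar>y\<bar> = \<bar>x\<bar>" for y :: real
  proof -
    obtain t where t: "\<bar>t\<bar> \<le> \<bar>y\<bar>" "exp y = (\<Sum>m<2. y ^ m / fact m) + exp t / fact 2 * y ^ 2"
      using Maclaurin_exp_le[of y 2] by blast
    have "exp t * y\<^sup>2 \<le> exp \<bar>x\<bar> * y\<^sup>2" using t(1) that by (intro mult_right_mono) auto
    then show ?thesis using t(2) by (simp add: eval_nat_numeral field_simps)
  qed
  have e4: "1 + y + y\<^sup>2 / 2 + y ^ 3 / 6 \<le> exp y"
      "exp y \<le> 1 + y + y\<^sup>2 / 2 + y ^ 3 / 6 + y ^ 4 / 24 * exp \<bar>x\<bar>" if "\<bar>y\<bar> = \<bar>x\<bar>" for y :: real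
  proof -
    obtain t where t: "\<bar>t\<bar> \<le> \<bar>y\<bar>" "exp y = (\<Sum>m<4. y ^ m / fact m) + exp t / fact 4 * y ^ 4"
      using Maclaurin_exp_le[of y 4] by blast
    have *: "exp y = 1 + y + y\<^sup>2 / 2 + y ^ 3 / 6 + exp t * y ^ 4 / 24"
      using t(2) by (simp add: lessThan_Suc eval_nat_numeral fact_numeral)
    have "exp t * y ^ 4 \<le> exp \<bar>x\<bar> * y ^ 4" using t(1) that by (intro mult_right_mono) auto
    then show "exp y \<le> 1 + y + y\<^sup>2 / 2 + y ^ 3 / 6 + y ^ 4 / 24 * exp \<bar>x\<bar>" using * by (simp add: mult.commute)
    have "0 \<le> exp t * y ^ 4" by simp
    then show "1 + y + y\<^sup>2 / 2 + y ^ 3 / 6 \<le> exp y" using * by simp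
  qed
  show "1 + x\<^sup>2 / 2 \<le> cosh x" using e4(1)[of x] e4(1)[of "-x"] by (simp add: cosh_def field_simps)
  show "cosh x \<le> 1 + x\<^sup>2 / 2 + x ^ 4 / 24 * exp \<bar>x\<bar>" using e4(2)[of x] e4(2)[of "-x"] by (simp add: cosh_def field_simps)
  show "cosh x \<le> 1 + x\<^sup>2 / 2 * exp \<bar>x\<bar>" using e2[of x] e2[of "-x"] by (simp add: cosh_def field_simps)
qed

text \<open>The features of the uniform law on the ball of radius \<open>sqrt r\<close> that drive
  the expansion: support, reflection symmetry, and variance \<open>\<kappa> * r\<close> in every
  direction. The cap \<open>r \<le> 1\<close> makes the bounds uniform in \<open>r\<close>.\<close>

locale small_symmetric_law = prob_space \<nu> for \<nu> :: "'a::euclidean_space measure" +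
  fixes r \<kappa> :: real
  assumes sets_law [simp, measurable_cong]: "sets \<nu> = sets borel"
    and r: "0 < r" "r \<le> 1"
    and bounded: "AE u in \<nu>. norm u \<le> sqrt r"
    and symmetric: "distr \<nu> borel uminus = \<nu>"
    and second_moment: "\<And>v. (\<integral>u. (v \<bullet> u)\<^sup>2 \<partial>\<nu>) = \<kappa> * r * (norm v)\<^sup>2"
begin

text \<open>The likelihood ratio at \<open>z\<close> of the mixture of unit Gaussians with means
  drawn from \<open>\<nu>\<close> against the standard Gaussian.\<close>

definition mgf :: "'a \<Rightarrow> real" where "mgf z = (\<integral>u. exp (z \<bullet> u - (norm u)\<^sup>2 / 2) \<partial>\<nu>)"

section \<open>Second-order control of the likelihood ratio\<close>

lemma inner_bound: "AE u in \<nu>. \<bar>z \<bullet> u\<bar> \<le> norm z * sqrt r"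
  using bounded
proof eventually_elim
  case (elim u)
  have "\<bar>z \<bullet> u\<bar> \<le> norm z * norm u" by (rule Cauchy_Schwarz_ineq2)
  also have "\<dots> \<le> norm z * sqrt r" using elim by (intro mult_left_mono) auto
  finally show ?case .
qed

lemma inner_bound1: "AE u in \<nu>. \<bar>z \<bullet> u\<bar> \<le> norm z"
  using inner_bound[of z]
proof eventually_elim
  case (elim u)
  have "norm z * sqrt r \<le> norm z * 1" using r by (intro mult_left_mono) auto
  then show ?case using elim by simp
qed

lemma integrable_exp_inner: "integrable \<nu> (\<lambda>u. exp (z \<bullet> u - c * (norm u)\<^sup>2))" if "0 \<le> c"
proof (rule integrable_const_bound[of _ "exp (norm z)"])
  show "AE u in \<nu>. norm (exp (z \<bullet> u - c * (norm u)\<^sup>2)) \<le> exp (norm z)"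
    using inner_bound1[of z]
  proof eventually_elim
    case (elim u)
    have "0 \<le> c * (norm u)\<^sup>2" using that by simp
    then have "z \<bullet> u - c * (norm u)\<^sup>2 \<le> norm z" using elim by linarith
    then show ?case by simp
  qed
qed measurable

lemma integral_uminus:
  assumes [measurable]: "f \<in> borel_measurable borel"
  shows "(\<integral>u. f (- u) \<partial>\<nu>) = (\<integral>u. (f u :: real) \<partial>\<nu>)"
proof -
  have "(\<integral>u. f u \<partial>\<nu>) = (\<integral>u. f u \<partial>distr \<nu> borel uminus)" by (simp add: symmetric)
  also have "\<dots> = (\<integral>u. f (- u) \<partial>\<nu>)" by (rule integral_distr) measurable
  finally show ?thesis by simp
qed

text \<open>Averaging over \<open>u\<close> and \<open>-u\<close> removes the first-order term in
  \<open>u\<close>. The case \<open>c = 1/2\<close> serves \<open>mgf\<close>, the case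
  \<open>c = 0\<close> serves \<open>mgf0\<close>.\<close>

lemma integral_exp_eq_cosh:
  assumes "0 \<le> c"
  shows "(\<integral>u. exp (z \<bullet> u - c * (norm u)\<^sup>2) \<partial>\<nu>) = (\<integral>u. exp (- c * (norm u)\<^sup>2) * cosh (z \<bullet> u) \<partial>\<nu>)"
    and "integrable \<nu> (\<lambda>u. exp (- c * (norm u)\<^sup>2) * cosh (z \<bullet> u))"
proof -
  have eq: "exp (- c * (norm u)\<^sup>2) * cosh (z \<bullet> u)
      = (exp (z \<bullet> u - c * (norm u)\<^sup>2) + exp (- z \<bullet> u - c * (norm u)\<^sup>2)) / 2" for u
    by (simp add: cosh_def exp_diff exp_minus field_simps)
  have i: "integrable \<nu> (\<lambda>u. exp (z \<bullet> u - c * (norm u)\<^sup>2))" "integrable \<nu> (\<lambda>u. exp (- z \<bullet> u - c * (norm u)\<^sup>2))"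
    using integrable_exp_inner[OF assms] by blast+
  show "integrable \<nu> (\<lambda>u. exp (- c * (norm u)\<^sup>2) * cosh (z \<bullet> u))" unfolding eq using i by simp
  have "(\<integral>u. exp (- z \<bullet> u - c * (norm u)\<^sup>2) \<partial>\<nu>) = (\<integral>u. exp (z \<bullet> u - c * (norm u)\<^sup>2) \<partial>\<nu>)"
    using integral_uminus[of "\<lambda>u. exp (z \<bullet> u - c * (norm u)\<^sup>2)"] by simp
  then show "(\<integral>u. exp (z \<bullet> u - c * (norm u)\<^sup>2) \<partial>\<nu>) = (\<integral>u. exp (- c * (norm u)\<^sup>2) * cosh (z \<bullet> u) \<partial>\<nu>)"
    unfolding eq using i by simp
qed

lemma mgf_cosh: "mgf z = (\<integral>u. exp (- (norm u)\<^sup>2 / 2) * cosh (z \<bullet> u) \<partial>\<nu>)"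
  and integrable_mgf: "integrable \<nu> (\<lambda>u. exp (z \<bullet> u - (norm u)\<^sup>2 / 2))"
  and integrable_mgf_cosh: "integrable \<nu> (\<lambda>u. exp (- (norm u)\<^sup>2 / 2) * cosh (z \<bullet> u))"
  using integral_exp_eq_cosh[of "1/2" z] integrable_exp_inner[of "1/2" z] by (simp_all add: mgf_def)

text \<open>Uniform in \<open>z\<close> because \<open>cosh \<ge> 1\<close>; together with
  \<open>r \<le> 1\<close> it keeps the likelihood ratio above \<open>1/2\<close>.\<close>

lemma mgf_lower: "1 - r / 2 \<le> mgf z"
proof -
  have "(\<integral>u. 1 - r / 2 \<partial>\<nu>) \<le> mgf z" unfolding mgf_cosh
  proof (rule integral_mono_AE[OF _ integrable_mgf_cosh])
    show "AE u in \<nu>. 1 - r / 2 \<le> exp (- (norm u)\<^sup>2 / 2) * cosh (z \<bullet> u)"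
      using bounded
    proof eventually_elim
      case (elim u)
      have "(norm u)\<^sup>2 \<le> (sqrt r)\<^sup>2" using elim by (intro power_mono) auto
      then have "1 - r / 2 \<le> 1 + - (norm u)\<^sup>2 / 2" using r by simp
      also have "\<dots> \<le> exp (- (norm u)\<^sup>2 / 2) * 1" using exp_ge_add_one_self[of "- (norm u)\<^sup>2 / 2"] by simp
      also have "\<dots> \<le> exp (- (norm u)\<^sup>2 / 2) * cosh (z \<bullet> u)" by (intro mult_left_mono cosh_real_ge_1) auto
      finally show ?case .
    qed
  qed simp
  then show ?thesis using prob_space by simp
qed

lemma mgf_pos: "1 / 2 \<le> mgf z" "0 < mgf z"
  using mgf_lower[of z] r by linarith+

text \<open>The hyperbolic cosine deviates from 1 by at most order
  \<open>(z \<bullet> u)^2 \<le> r * norm z ^ 2\<close>. The growth \<open>exp (2 * norm z)\<close>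
  is harmless because it remains integrable against Gaussians.\<close>

lemma mgf_upper: "mgf z \<le> 1 + r * exp (2 * norm z)"
proof -
  have "mgf z \<le> (\<integral>u. 1 + r * exp (2 * norm z) \<partial>\<nu>)" unfolding mgf_cosh
  proof (rule integral_mono_AE[OF integrable_mgf_cosh])
    show "AE u in \<nu>. exp (- (norm u)\<^sup>2 / 2) * cosh (z \<bullet> u) \<le> 1 + r * exp (2 * norm z)"
      using inner_bound[of z] inner_bound1[of z]
    proof eventually_elim
      case (elim u)
      have "(z \<bullet> u)\<^sup>2 \<le> (norm z * sqrt r)\<^sup>2" using elim(1) by (rule abs_le_square_iff[THEN iffD1, OF order_trans]) simp
      then have sq: "(z \<bullet> u)\<^sup>2 \<le> r * (norm z)\<^sup>2" using r by (simp add: power_mult_distrib mult.commute)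
      \<comment> \<open>Absorbs the polynomial factor, leaving a purely exponential bound.\<close>
      have e: "(norm z)\<^sup>2 / 2 \<le> exp (norm z)" using exp_lower_Taylor_quadratic[of "norm z"] norm_ge_zero[of z] by linarith
      have "exp (- (norm u)\<^sup>2 / 2) * cosh (z \<bullet> u) \<le> 1 * cosh (z \<bullet> u)"
        by (intro mult_right_mono) (auto simp: cosh_real_nonneg)
      also have "\<dots> \<le> 1 + (z \<bullet> u)\<^sup>2 / 2 * exp \<bar>z \<bullet> u\<bar>" using cosh_bounds(3) by simp
      also have "(z \<bullet> u)\<^sup>2 / 2 * exp \<bar>z \<bullet> u\<bar> \<le> (r * (norm z)\<^sup>2) / 2 * exp (norm z)"
        using sq elim(2) r by (intro mult_mono) auto
      also have "\<dots> \<le> r * (exp (norm z) * exp (norm z))"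
        using mult_right_mono[OF e, of "r * exp (norm z)"] r by (simp add: mult_ac)
      finally show ?case by (simp add: exp_add[symmetric])
    qed
  qed simp
  then show ?thesis using prob_space by simp
qed

lemma mgf_minus_1_square: "(mgf z - 1)\<^sup>2 \<le> r\<^sup>2 * exp (4 * norm z)"
proof -
  have "r * 1 \<le> r * exp (2 * norm z)" using r by (intro mult_left_mono) auto
  then have "\<bar>mgf z - 1\<bar> \<le> r * exp (2 * norm z)" using mgf_lower[of z] mgf_upper[of z] r by linarith
  then have "(mgf z - 1)\<^sup>2 \<le> (r * exp (2 * norm z))\<^sup>2"
    by (rule abs_le_square_iff[THEN iffD1, OF order_trans]) simp
  then show ?thesis by (simp add: power_mult_distrib exp_double[symmetric])
qed

text \<open>From \<open>1/m + m = 2 + (m - 1)^2 / m\<close> with \<open>m \<ge> 1/2\<close>. It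
  trades \<open>1/m\<close> for \<open>2 - m\<close> at cost \<open>O(r^2)\<close>, and the Gaussian
  mean of \<open>m\<close> is computable.\<close>

lemma inverse_mgf: "2 \<le> 1 / mgf z + mgf z" "1 / mgf z + mgf z \<le> 2 + 2 * r\<^sup>2 * exp (4 * norm z)"
proof -
  have eq: "1 / mgf z + mgf z = 2 + (mgf z - 1)\<^sup>2 / mgf z"
    using mgf_pos[of z] by (simp add: field_simps power2_eq_square)
  show "2 \<le> 1 / mgf z + mgf z" unfolding eq using mgf_pos[of z] by simp
  have "(mgf z - 1)\<^sup>2 / mgf z \<le> (mgf z - 1)\<^sup>2 / (1/2)" using mgf_pos[of z] by (intro divide_left_mono) auto
  also have "\<dots> \<le> 2 * r\<^sup>2 * exp (4 * norm z)" using mgf_minus_1_square[of z] by simp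
  finally show "1 / mgf z + mgf z \<le> 2 + 2 * r\<^sup>2 * exp (4 * norm z)" unfolding eq by simp
qed

lemma borel_measurable_mgf [measurable]: "mgf \<in> borel_measurable borel"
  unfolding mgf_def by (rule borel_measurable_lebesgue_integral) measurable

text \<open>The untilted moment generating function; by \<open>nn_integral_std_gauss_mgf\<close> it
  is the mean of \<open>mgf\<close> under the unit Gaussian centred at \<open>a\<close>.\<close>

definition mgf0 :: "'a \<Rightarrow> real" where "mgf0 a = (\<integral>u. exp (a \<bullet> u) \<partial>\<nu>)"

lemma mgf0_cosh: "mgf0 a = (\<integral>u. cosh (a \<bullet> u) \<partial>\<nu>)"
  and integrable_mgf0: "integrable \<nu> (\<lambda>u. exp (a \<bullet> u))"
  and integrable_mgf0_cosh: "integrable \<nu> (\<lambda>u. cosh (a \<bullet> u))"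
  using integral_exp_eq_cosh[of 0 a] integrable_exp_inner[of 0 a] by (simp_all add: mgf0_def)

text \<open>The quadratic term of \<open>cosh\<close> integrates to the second moment, and the
  support bound makes the quartic remainder \<open>O(r^2)\<close>.\<close>

lemma mgf0_bounds:
  shows "1 + \<kappa> * r * (norm a)\<^sup>2 / 2 \<le> mgf0 a"
    and "mgf0 a \<le> 1 + \<kappa> * r * (norm a)\<^sup>2 / 2 + r\<^sup>2 * (norm a ^ 4 * exp (norm a))"
proof -
  have int: "integrable \<nu> (\<lambda>u. (a \<bullet> u)\<^sup>2)"
  proof (rule integrable_const_bound[of _ "(norm a)\<^sup>2"])
    show "AE u in \<nu>. norm ((a \<bullet> u)\<^sup>2) \<le> (norm a)\<^sup>2"
      using inner_bound1[of a] by eventually_elim (simp add: abs_le_square_iff[symmetric])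
  qed measurable
  have "(\<integral>u. 1 + (a \<bullet> u)\<^sup>2 / 2 \<partial>\<nu>) \<le> mgf0 a" unfolding mgf0_cosh
    using int cosh_bounds(1) by (intro integral_mono integrable_mgf0_cosh) auto
  then show "1 + \<kappa> * r * (norm a)\<^sup>2 / 2 \<le> mgf0 a"
    using int prob_space by (simp add: second_moment)
  have "mgf0 a \<le> (\<integral>u. 1 + (a \<bullet> u)\<^sup>2 / 2 + r\<^sup>2 * (norm a ^ 4 * exp (norm a)) \<partial>\<nu>)" unfolding mgf0_cosh
  proof (rule integral_mono_AE[OF integrable_mgf0_cosh])
    show "AE u in \<nu>. cosh (a \<bullet> u) \<le> 1 + (a \<bullet> u)\<^sup>2 / 2 + r\<^sup>2 * (norm a ^ 4 * exp (norm a))"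
      using inner_bound[of a] inner_bound1[of a]
    proof eventually_elim
      case (elim u)
      have "\<bar>a \<bullet> u\<bar> ^ 4 \<le> (norm a * sqrt r) ^ 4" using elim(1) by (intro power_mono) auto
      also have "\<dots> = r\<^sup>2 * norm a ^ 4"
        using r power_mult[of "sqrt r" 2 2] by (simp add: power_mult_distrib mult.commute)
      finally have "(a \<bullet> u) ^ 4 \<le> r\<^sup>2 * norm a ^ 4" by simp
      moreover have "0 \<le> r\<^sup>2 * norm a ^ 4" by simp
      ultimately have "(a \<bullet> u) ^ 4 / 24 \<le> r\<^sup>2 * norm a ^ 4" by linarith
      then have "(a \<bullet> u) ^ 4 / 24 * exp \<bar>a \<bullet> u\<bar> \<le> (r\<^sup>2 * norm a ^ 4) * exp (norm a)"
        using elim(2) by (intro mult_mono) auto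
      then show ?case using cosh_bounds(2)[of "a \<bullet> u"] by (simp add: mult.assoc)
    qed
  qed (use int in simp)
  then show "mgf0 a \<le> 1 + \<kappa> * r * (norm a)\<^sup>2 / 2 + r\<^sup>2 * (norm a ^ 4 * exp (norm a))"
    using int prob_space by (simp add: second_moment)
qed

text \<open>After exchanging the integrals, tilting shifts the Gaussian, whose mass is 1, and leaves
  \<open>exp (a \<bullet> u)\<close>.\<close>

lemma nn_integral_std_gauss_mgf:
  "(\<integral>\<^sup>+z. ennreal (std_gauss (z - a) * mgf z) \<partial>lborel) = ennreal (mgf0 a)"
proof -
  interpret pair_sigma_finite lborel \<nu> ..
  have "(\<integral>\<^sup>+z. ennreal (std_gauss (z - a) * mgf z) \<partial>lborel)
      = (\<integral>\<^sup>+z. (\<integral>\<^sup>+u. ennreal (std_gauss (z - a) * exp (z \<bullet> u - (norm u)\<^sup>2 / 2)) \<partial>\<nu>) \<partial>lborel)"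
  proof (rule nn_integral_cong)
    fix z
    have "ennreal (mgf z) = (\<integral>\<^sup>+u. ennreal (exp (z \<bullet> u - (norm u)\<^sup>2 / 2)) \<partial>\<nu>)"
      unfolding mgf_def by (rule nn_integral_eq_integral[symmetric]) (auto intro: integrable_mgf)
    then show "ennreal (std_gauss (z - a) * mgf z)
        = (\<integral>\<^sup>+u. ennreal (std_gauss (z - a) * exp (z \<bullet> u - (norm u)\<^sup>2 / 2)) \<partial>\<nu>)"
      by (subst nn_integral_cmult_ennreal) (simp_all add: ennreal_mult')
  qed
  also have "\<dots> = (\<integral>\<^sup>+u. (\<integral>\<^sup>+z. ennreal (std_gauss (z - a) * exp (z \<bullet> u - (norm u)\<^sup>2 / 2)) \<partial>lborel) \<partial>\<nu>)"
    by (rule Fubini'[symmetric]) measurable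
  also have "\<dots> = (\<integral>\<^sup>+u. ennreal (exp (a \<bullet> u)) \<partial>\<nu>)"
    unfolding std_gauss_mult_exp
    by (subst nn_integral_cmult_ennreal) (simp_all add: nn_integral_std_gauss)
  also have "\<dots> = ennreal (mgf0 a)"
    unfolding mgf0_def by (rule nn_integral_eq_integral) (auto intro: integrable_mgf0)
  finally show ?thesis .
qed

end

text \<open>Half of the Gaussian exponent absorbs the exponential growth; what remains has variance
  2, hence the factor \<open>sqrt 2\<close> per dimension.\<close>

lemma nn_integral_std_gauss_exp_norm:
  fixes a :: "'a::euclidean_space"
  shows "(\<integral>\<^sup>+z. ennreal (std_gauss (z - a) * exp (4 * norm z)) \<partial>lborel)
    \<le> ennreal (exp (16 + 4 * norm a) * sqrt 2 ^ DIM('a))"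
proof -
  define c where "c = exp (16 + 4 * norm a) / sqrt (2 * pi) ^ DIM('a)"
  have c: "c \<ge> 0" by (simp add: c_def)
  have "(\<integral>\<^sup>+z. ennreal (std_gauss (z - a) * exp (4 * norm z)) \<partial>lborel)
      \<le> (\<integral>\<^sup>+z. ennreal (c * exp (- (1/4) * (norm (z - a))\<^sup>2)) \<partial>lborel)"
  proof (rule nn_integral_mono, rule ennreal_leI)
    fix z
    have "norm z \<le> norm (z - a) + norm a" by (metis norm_triangle_sub add.commute)
    \<comment> \<open>Expanding \<open>(norm (z - a) / 2 - 4)^2 \<ge> 0\<close>.\<close>
    moreover have "4 * norm (z - a) \<le> (norm (z - a))\<^sup>2 / 4 + 16"
      using zero_le_power2[of "norm (z - a) / 2 - 4"] by (simp add: power2_eq_square field_simps)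
    ultimately have "- (norm (z - a))\<^sup>2 / 2 + 4 * norm z \<le> (16 + 4 * norm a) + - (1/4) * (norm (z - a))\<^sup>2"
      by (simp add: field_simps)
    then have "exp (- (norm (z - a))\<^sup>2 / 2) * exp (4 * norm z) \<le> exp (16 + 4 * norm a) * exp (- (1/4) * (norm (z - a))\<^sup>2)"
      by (simp only: exp_add[symmetric] exp_le_cancel_iff)
    then show "std_gauss (z - a) * exp (4 * norm z) \<le> c * exp (- (1/4) * (norm (z - a))\<^sup>2)"
      by (simp add: std_gauss_def c_def divide_right_mono)
  qed
  also have "\<dots> = ennreal (c * sqrt (pi / (1/4)) ^ DIM('a))"
    using c by (subst nn_integral_cmult_ennreal, simp, simp, subst nn_integral_exp_minus_norm_square)
      (auto simp: ennreal_mult)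
  also have "c * sqrt (pi / (1/4)) ^ DIM('a) = exp (16 + 4 * norm a) * sqrt 2 ^ DIM('a)"
  proof -
    have "sqrt (pi / (1/4)) = sqrt (2 * pi) * sqrt 2" by (simp add: real_sqrt_mult)
    then show ?thesis by (simp add: c_def power_mult_distrib)
  qed
  finally show ?thesis .
qed

text \<open>The mean of \<open>1 / mgf\<close> plus that of \<open>mgf\<close> is
  \<open>2 + O(r^2)\<close>, and the latter is known to first order. The constant \<open>C\<close>
  depends on \<open>R\<close> and the dimension but not on \<open>v\<close> or \<open>r\<close>, as
  the supremum over \<open>v\<close> requires.\<close>

lemma (in small_symmetric_law) chi_square_integral_expansion:
  fixes v :: 'a
  assumes v: "(norm v)\<^sup>2 \<le> R"
  defines "C \<equiv> 16 * R\<^sup>2 * exp (2 * sqrt R) + 2 * (exp (16 + 8 * sqrt R) * sqrt 2 ^ DIM('a))"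
  obtains j where
    "(\<integral>\<^sup>+z. ennreal ((std_gauss (z - v))\<^sup>2 / (std_gauss z * mgf z)) \<partial>lborel) = ennreal (exp ((norm v)\<^sup>2) * j)"
    "\<bar>j - (1 - 2 * \<kappa> * r * (norm v)\<^sup>2)\<bar> \<le> C * r\<^sup>2"
proof -
  define a where "a = 2 *\<^sub>R v"
  define s where "s = sqrt R"
  have R: "R \<ge> 0" using v by (meson order_trans zero_le_power2)
  have ns: "norm v \<le> s" unfolding s_def using v real_le_rsqrt by blast
  have na: "norm a = 2 * norm v" by (simp add: a_def)
  define K where "K = exp (16 + 8 * s) * sqrt 2 ^ DIM('a)"
  have K: "K \<ge> 0" by (simp add: K_def)
  define J where "J = (\<integral>\<^sup>+z. ennreal (std_gauss (z - a) * (1 / mgf z)) \<partial>lborel)"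
  have m0: "0 \<le> mgf z" "mgf z \<noteq> 0" for z using mgf_pos[of z] by linarith+
  have M0: "0 \<le> mgf0 a" unfolding mgf0_def by (intro integral_nonneg_AE) auto
  \<comment> \<open>Estimating the sum rather than \<open>2 - mgf\<close> keeps all integrands
    nonnegative.\<close>
  have sum: "J + ennreal (mgf0 a) = (\<integral>\<^sup>+z. ennreal (std_gauss (z - a) * (1 / mgf z + mgf z)) \<partial>lborel)"
    unfolding J_def nn_integral_std_gauss_mgf[symmetric]
    by (subst nn_integral_add[symmetric]) (auto simp: m0 distrib_left simp flip: ennreal_plus intro!: nn_integral_cong)
  have "2 = (\<integral>\<^sup>+z. ennreal (2 * std_gauss (z - a)) \<partial>lborel)"
    by (subst nn_integral_cmult_ennreal) (auto simp: nn_integral_std_gauss)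
  also have "\<dots> \<le> J + ennreal (mgf0 a)" unfolding sum
    using inverse_mgf(1) by (intro nn_integral_mono ennreal_leI) (simp add: mult.commute[of 2] mult_left_mono)
  finally have low: "2 \<le> J + ennreal (mgf0 a)" .
  have "J + ennreal (mgf0 a) \<le> (\<integral>\<^sup>+z. ennreal (2 * std_gauss (z - a) + 2 * r\<^sup>2 * (std_gauss (z - a) * exp (4 * norm z))) \<partial>lborel)"
    unfolding sum
  proof (intro nn_integral_mono ennreal_leI)
    fix z
    have "std_gauss (z - a) * (1 / mgf z + mgf z) \<le> std_gauss (z - a) * (2 + 2 * r\<^sup>2 * exp (4 * norm z))"
      using inverse_mgf(2) by (intro mult_left_mono) auto
    then show "std_gauss (z - a) * (1 / mgf z + mgf z)
        \<le> 2 * std_gauss (z - a) + 2 * r\<^sup>2 * (std_gauss (z - a) * exp (4 * norm z))"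
      by (simp add: algebra_simps)
  qed
  also have "\<dots> = (\<integral>\<^sup>+z. ennreal (2 * std_gauss (z - a)) + ennreal (2 * r\<^sup>2 * (std_gauss (z - a) * exp (4 * norm z))) \<partial>lborel)"
    by (intro nn_integral_cong ennreal_plus) auto
  also have "\<dots> = (\<integral>\<^sup>+z. ennreal (2 * std_gauss (z - a)) \<partial>lborel)
      + (\<integral>\<^sup>+z. ennreal (2 * r\<^sup>2 * (std_gauss (z - a) * exp (4 * norm z))) \<partial>lborel)"
    by (rule nn_integral_add) measurable
  also have "(\<integral>\<^sup>+z. ennreal (2 * std_gauss (z - a)) \<partial>lborel) = 2"
    by (subst nn_integral_cmult_ennreal) (auto simp: nn_integral_std_gauss)
  also have "(\<integral>\<^sup>+z. ennreal (2 * r\<^sup>2 * (std_gauss (z - a) * exp (4 * norm z))) \<partial>lborel)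
      = ennreal (2 * r\<^sup>2) * (\<integral>\<^sup>+z. ennreal (std_gauss (z - a) * exp (4 * norm z)) \<partial>lborel)"
    by (rule nn_integral_cmult_ennreal) auto
  also have "\<dots> \<le> ennreal (2 * r\<^sup>2) * ennreal K"
  proof (intro mult_left_mono order_trans[OF nn_integral_std_gauss_exp_norm] ennreal_leI)
    show "exp (16 + 4 * norm a) * sqrt 2 ^ DIM('a) \<le> K"
      unfolding K_def using ns by (intro mult_right_mono) (auto simp: na)
  qed simp
  finally have "J + ennreal (mgf0 a) \<le> 2 + ennreal (2 * r\<^sup>2) * ennreal K" by (simp add: add_left_mono)
  then have up: "J + ennreal (mgf0 a) \<le> ennreal (2 + 2 * r\<^sup>2 * K)"
    using K by (simp add: ennreal_mult ennreal_plus)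
  \<comment> \<open>Finiteness comes from the upper bound itself; from here on the estimate is real
    arithmetic.\<close>
  then have "J \<noteq> top" by (auto simp: top_unique)
  then obtain j where j: "0 \<le> j" "J = ennreal j" by (cases J) auto
  have low': "2 \<le> j + mgf0 a"
    using low j M0 by (simp flip: ennreal_plus ennreal_numeral add: ennreal_le_iff)
  have up': "j + mgf0 a \<le> 2 + 2 * r\<^sup>2 * K"
    using up j M0 K by (simp flip: ennreal_plus add: ennreal_le_iff)
  have quad: "\<kappa> * r * (norm a)\<^sup>2 / 2 = 2 * \<kappa> * r * (norm v)\<^sup>2" by (simp add: na power_mult_distrib)
  have "norm a ^ 4 * exp (norm a) \<le> 16 * R\<^sup>2 * exp (2 * sqrt R)"
  proof (rule mult_mono)
    have "((norm v)\<^sup>2)\<^sup>2 \<le> R\<^sup>2" using v by (intro power_mono) auto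
    then show "norm a ^ 4 \<le> 16 * R\<^sup>2" by (simp add: na power_mult_distrib flip: power_mult)
    show "exp (norm a) \<le> exp (2 * sqrt R)" using ns by (simp add: na s_def)
  qed (use R in auto)
  then have tail: "r\<^sup>2 * (norm a ^ 4 * exp (norm a)) \<le> r\<^sup>2 * (16 * R\<^sup>2 * exp (2 * sqrt R))"
    by (intro mult_left_mono) auto
  \<comment> \<open>One summand pays for the quartic tail of \<open>mgf0\<close>, the other for
    replacing \<open>1 / mgf\<close>.\<close>
  have C: "C * r\<^sup>2 = r\<^sup>2 * (16 * R\<^sup>2 * exp (2 * sqrt R)) + 2 * r\<^sup>2 * K"
    by (simp add: C_def K_def s_def algebra_simps)
  have nonneg: "0 \<le> r\<^sup>2 * (16 * R\<^sup>2 * exp (2 * sqrt R))" "0 \<le> 2 * r\<^sup>2 * K" using K R by auto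
  have "\<bar>j - (1 - 2 * \<kappa> * r * (norm v)\<^sup>2)\<bar> \<le> C * r\<^sup>2"
    using low' up' mgf0_bounds[of a] tail nonneg unfolding quad C by linarith
  moreover have "(\<integral>\<^sup>+z. ennreal ((std_gauss (z - v))\<^sup>2 / (std_gauss z * mgf z)) \<partial>lborel) = ennreal (exp ((norm v)\<^sup>2) * j)"
  proof -
    have "(std_gauss (z - v))\<^sup>2 / (std_gauss z * mgf z) = exp ((norm v)\<^sup>2) * (std_gauss (z - a) * (1 / mgf z))" for z
      using std_gauss_square_quotient[of z v] by (simp add: a_def flip: divide_divide_eq_left)
    then show ?thesis using j
      by (simp add: nn_integral_cmult_ennreal J_def[symmetric] ennreal_mult del: mult_1_right times_divide_eq_right)
  qed
  ultimately show thesis using that by blast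
qed

subsection \<open>The one-sided derivative\<close>

text \<open>Differences are taken in \<open>ereal\<close> because subtraction in
  \<open>ennreal\<close> truncates at 0 and would hide a decrease. Where \<open>l\<close> is given
  by a nonnegative real function the quotient is an ordinary one.\<close>

lemma tendsto_ereal_difference_quotient:
  fixes l :: "real \<Rightarrow> ennreal" and g :: "real \<Rightarrow> real"
  assumes ev: "eventually (\<lambda>r. l r = ennreal (g r) \<and> 0 \<le> g r) (at_right 0)"
    and l0: "l 0 = ennreal (g 0)" "0 \<le> g 0"
    and lim: "((\<lambda>r. (g r - g 0) / r) \<longlongrightarrow> c) (at_right 0)"
  shows "((\<lambda>r. (enn2ereal (l r) - enn2ereal (l 0)) / ereal r) \<longlongrightarrow> ereal c) (at_right 0)"
proof (rule Lim_transform_eventually)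
  show "((\<lambda>r. ereal ((g r - g 0) / r)) \<longlongrightarrow> ereal c) (at_right 0)"
    using lim by (rule tendsto_ereal)
  show "eventually (\<lambda>r. ereal ((g r - g 0) / r) = (enn2ereal (l r) - enn2ereal (l 0)) / ereal r) (at_right 0)"
    using ev eventually_at_right_less[of 0]
    by eventually_elim (simp add: l0 enn2ereal_ennreal)
qed

lemma SUP_ball_le:
  fixes f :: "'a::real_normed_vector \<Rightarrow> ennreal"
  assumes "\<And>v. (norm v)\<^sup>2 \<le> R \<Longrightarrow> f v \<le> c"
  shows "(SUP v\<in>{v. (norm v)\<^sup>2 \<le> R}. f v) \<le> c"
  using assms by (intro SUP_least) auto

lemma obtain_norm_square:
  assumes "0 \<le> R"
  obtains v :: "'a::euclidean_space" where "(norm v)\<^sup>2 = R"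
proof -
  obtain v :: 'a where "norm v = sqrt R" using vector_choose_size[of "sqrt R"] assms by auto
  then show thesis using that[of v] assms by simp
qed

context whitening
begin

lemma l_fun_whitened:
  assumes "U = (\<lambda>v. th + A *v v) ` {v. (norm v)\<^sup>2 \<le> R}"
  shows "l_fun Sigma \<mu> U r = (SUP v\<in>{v. (norm v)\<^sup>2 \<le> R}. L_fun Sigma \<mu> r (th + A *v v))"
  by (simp add: l_fun_def assms image_image)

lemma l_fun_0:
  assumes U: "U = (\<lambda>v. th + A *v v) ` {v. (norm v)\<^sup>2 \<le> R}" and R: "0 \<le> R"
    and "\<mu> 0 = return borel th"
  shows "l_fun Sigma \<mu> U 0 = ennreal (exp R)"
proof (rule antisym)
  show "l_fun Sigma \<mu> U 0 \<le> ennreal (exp R)"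
    unfolding l_fun_whitened[OF U] L_fun_0[where \<mu>=\<mu>, OF assms(3)] by (intro SUP_ball_le ennreal_leI) simp
  obtain v :: "real^'n" where v: "(norm v)\<^sup>2 = R" using obtain_norm_square[OF R] .
  then have "ennreal (exp R) = L_fun Sigma \<mu> 0 (th + A *v v)" using L_fun_0[where \<mu>=\<mu>, OF assms(3)] by simp
  also have "\<dots> \<le> l_fun Sigma \<mu> U 0"
    unfolding l_fun_whitened[OF U] using v by (intro SUP_upper) simp
  finally show "ennreal (exp R) \<le> l_fun Sigma \<mu> U 0" .
qed

text \<open>For fixed \<open>r\<close> the closed form increases with \<open>norm v\<close>, so the
  supremum is attained on the boundary sphere.\<close>

lemma l_fun_gauss:
  assumes U: "U = (\<lambda>v. th + A *v v) ` {v. (norm v)\<^sup>2 \<le> R}" and R: "0 \<le> R" and r: "0 \<le> r"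
  shows "l_fun Sigma (mu_gauss th Sigma) U r
    = ennreal (((1 + r) / sqrt (1 + 2 * r)) ^ CARD('n) * exp (R / (1 + 2 * r)))"
proof (rule antisym)
  show "l_fun Sigma (mu_gauss th Sigma) U r
      \<le> ennreal (((1 + r) / sqrt (1 + 2 * r)) ^ CARD('n) * exp (R / (1 + 2 * r)))"
    unfolding l_fun_whitened[OF U] L_fun_gauss[OF r] using r
    by (intro SUP_ball_le ennreal_leI mult_left_mono) (auto simp: divide_right_mono)
  obtain v :: "real^'n" where v: "(norm v)\<^sup>2 = R" using obtain_norm_square[OF R] .
  then have "ennreal (((1 + r) / sqrt (1 + 2 * r)) ^ CARD('n) * exp (R / (1 + 2 * r)))
      = L_fun Sigma (mu_gauss th Sigma) r (th + A *v v)" using L_fun_gauss[OF r] by simp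
  also have "\<dots> \<le> l_fun Sigma (mu_gauss th Sigma) U r"
    unfolding l_fun_whitened[OF U] using v by (intro SUP_upper) simp
  finally show "ennreal (((1 + r) / sqrt (1 + 2 * r)) ^ CARD('n) * exp (R / (1 + 2 * r)))
      \<le> l_fun Sigma (mu_gauss th Sigma) U r" .
qed

lemma l_fun_gauss_derivative:
  assumes U: "U = (\<lambda>v. th + A *v v) ` {v. (norm v)\<^sup>2 \<le> R}" and R: "0 \<le> R"
  defines "l \<equiv> l_fun Sigma (mu_gauss th Sigma) U"
  shows "((\<lambda>r. (enn2ereal (l r) - enn2ereal (l 0)) / ereal r) \<longlongrightarrow> ereal (- (2 * R * exp R))) (at_right 0)"
proof -
  define g where "g r = ((1 + r) / sqrt (1 + 2 * r)) ^ CARD('n) * exp (R / (1 + 2 * r))" for r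
  \<comment> \<open>The dimensional factor is stationary at 0, so only the exponential contributes
    to the derivative.\<close>
  have "((\<lambda>r. (1 + r) / sqrt (1 + 2 * r)) has_real_derivative 0) (at 0)"
    by (auto intro!: derivative_eq_intros)
  from DERIV_mult[OF DERIV_power[OF this, of "CARD('n)"]]
  have "(g has_real_derivative - (2 * R * exp R)) (at 0)"
    unfolding g_def by (rule DERIV_cong) (auto intro!: derivative_eq_intros)
  then have "((\<lambda>r. (g r - g 0) / r) \<longlongrightarrow> - (2 * R * exp R)) (at 0)"
    by (simp add: has_field_derivative_iff)
  then have lim: "((\<lambda>r. (g r - g 0) / r) \<longlongrightarrow> - (2 * R * exp R)) (at_right 0)"
    by (rule filterlim_mono) (auto simp: at_within_le_at)
  show ?thesis
  proof (rule tendsto_ereal_difference_quotient[OF _ _ _ lim])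
    show "eventually (\<lambda>r. l r = ennreal (g r) \<and> 0 \<le> g r) (at_right 0)"
      using eventually_at_right_less[of 0]
      by eventually_elim (simp add: l_def g_def l_fun_gauss[OF U R])
  qed (simp_all add: l_def g_def l_fun_gauss[OF U R])
qed

text \<open>Tilting the standard Gaussian by \<open>u\<close> gives the unit Gaussian around
  \<open>u\<close>, so in whitened coordinates the mixture is \<open>std_gauss * mgf\<close>, up to
  the determinant.\<close>

lemma L_fun_ball:
  assumes A: "A = matrix_sqrt Sigma"
    and law: "small_symmetric_law (uniform_measure lborel (cball (0::real^'n) (sqrt r))) r \<kappa>"
  shows "L_fun Sigma (mu_ball th Sigma) r (th + A *v v)
    = (\<integral>\<^sup>+z. ennreal ((std_gauss (z - v))\<^sup>2 /
        (std_gauss z * small_symmetric_law.mgf (uniform_measure lborel (cball 0 (sqrt r))) z)) \<partial>lborel)"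
proof -
  let ?\<nu> = "uniform_measure lborel (cball (0::real^'n) (sqrt r))"
  interpret small_symmetric_law ?\<nu> r \<kappa> by (rule law)
  show ?thesis
  proof (rule L_fun_whitened)
    show "(\<lambda>z. std_gauss z * mgf z) \<in> borel_measurable borel" by measurable
    fix z
    have "mix_density Sigma (mu_ball th Sigma r) (th + A *v z)
        = (\<integral>u. mvn_density (th + A *v u) Sigma (th + A *v z) \<partial>?\<nu>)"
      using r by (simp add: mix_density_def mu_ball_def A[symmetric] mvn_density_def integral_distr)
    also have "\<dots> = (\<integral>u. std_gauss z / \<bar>det A\<bar> * exp (z \<bullet> u - (norm u)\<^sup>2 / 2) \<partial>?\<nu>)"
      using std_gauss_mult_exp[of z 0] by (simp add: mvn_density_std)
    also have "\<dots> = std_gauss z * mgf z / \<bar>det A\<bar>" by (simp add: mgf_def)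
    finally show "mix_density Sigma (mu_ball th Sigma r) (th + A *v z) = std_gauss z * mgf z / \<bar>det A\<bar>" .
  qed
qed

text \<open>The expansion of \<open>L\<close> is uniform over the ball, so the supremum is squeezed
  between values at \<open>norm v ^ 2 = R\<close> that agree up to \<open>O(r^2)\<close>.\<close>

lemma l_fun_ball_derivative:
  assumes A: "A = matrix_sqrt Sigma"
    and U: "U = (\<lambda>v. th + A *v v) ` {v. (norm v)\<^sup>2 \<le> R}" and R: "0 \<le> R"
  defines "l \<equiv> l_fun Sigma (mu_ball th Sigma) U"
  obtains \<kappa> :: real where "0 < \<kappa>"
    "((\<lambda>r. (enn2ereal (l r) - enn2ereal (l 0)) / ereal r) \<longlongrightarrow> ereal (- (2 * \<kappa> * R * exp R))) (at_right 0)"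
proof -
  obtain \<kappa> where \<kappa>: "0 < \<kappa>" and sec: "\<And>s v. 0 < s \<Longrightarrow>
      (\<integral>u. (v \<bullet> u)\<^sup>2 \<partial>uniform_measure lborel (cball (0::real^'n) s)) = \<kappa> * s\<^sup>2 * (norm v)\<^sup>2"
    using uniform_cball_second_moment by blast
  let ?\<nu> = "\<lambda>r. uniform_measure lborel (cball (0::real^'n) (sqrt r))"
  have law: "small_symmetric_law (?\<nu> r) r \<kappa>" if "0 < r" "r \<le> 1" for r
  proof -
    interpret prob_space "?\<nu> r" using that by (intro prob_space_uniform_cball) simp
    show ?thesis
    proof
      show "AE u in ?\<nu> r. norm u \<le> sqrt r" by (rule AE_uniform_measureI) auto
      show "(\<integral>u. (v \<bullet> u)\<^sup>2 \<partial>?\<nu> r) = \<kappa> * r * (norm v)\<^sup>2" for v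
        using sec[of "sqrt r" v] that by simp
    qed (use that uniform_cball_symmetric in auto)
  qed
  define C where "C = 16 * R\<^sup>2 * exp (2 * sqrt R) + 2 * (exp (16 + 8 * sqrt R) * sqrt 2 ^ DIM(real^'n))"
  have C: "C \<ge> 0" unfolding C_def by (intro add_nonneg_nonneg mult_nonneg_nonneg) auto
  have L: "\<exists>j. L_fun Sigma (mu_ball th Sigma) r (th + A *v v) = ennreal (exp ((norm v)\<^sup>2) * j)
      \<and> \<bar>j - (1 - 2 * \<kappa> * r * (norm v)\<^sup>2)\<bar> \<le> C * r\<^sup>2"
    if r: "0 < r" "r \<le> 1" and v: "(norm v)\<^sup>2 \<le> R" for r v
  proof -
    interpret small_symmetric_law "?\<nu> r" r \<kappa> using law r by blast
    obtain j where
      "(\<integral>\<^sup>+z. ennreal ((std_gauss (z - v))\<^sup>2 / (std_gauss z * mgf z)) \<partial>lborel) = ennreal (exp ((norm v)\<^sup>2) * j)"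
      "\<bar>j - (1 - 2 * \<kappa> * r * (norm v)\<^sup>2)\<bar> \<le> C * r\<^sup>2"
      unfolding C_def by (rule chi_square_integral_expansion[OF v])
    then show ?thesis unfolding L_fun_ball[OF A law[OF r]] by (intro exI[of _ j]) simp
  qed
  define g where "g r = enn2real (l r)" for r
  have l0: "l 0 = ennreal (exp R)" unfolding l_def
    by (rule l_fun_0[OF U R]) (simp add: mu_ball_def)
  have bounds: "l r = ennreal (g r)" "\<bar>g r - exp R * (1 - 2 * \<kappa> * r * R)\<bar> \<le> exp R * C * r\<^sup>2"
    if r: "0 < r" "r \<le> 1" "2 * \<kappa> * r * (R + 1) \<le> 1" for r
  proof -
    define P where "P = 1 - 2 * \<kappa> * r * R + C * r\<^sup>2"
    have "0 \<le> C * r\<^sup>2" using C by simp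
    \<comment> \<open>The smallness condition on \<open>r\<close> is chosen to give this: the
      first-order slope in \<open>norm v ^ 2\<close> must not exceed \<open>P\<close>.\<close>
    then have P: "2 * \<kappa> * r \<le> P" using r(3) unfolding P_def by (simp add: algebra_simps)
    then have P0: "0 \<le> P" using \<kappa> r(1) by (smt (verit) mult_nonneg_nonneg)
    have upper: "l r \<le> ennreal (exp R * P)" unfolding l_def l_fun_whitened[OF U]
    proof (rule SUP_ball_le)
      fix v :: "real^'n" assume v: "(norm v)\<^sup>2 \<le> R"
      obtain j where j: "L_fun Sigma (mu_ball th Sigma) r (th + A *v v) = ennreal (exp ((norm v)\<^sup>2) * j)"
        "\<bar>j - (1 - 2 * \<kappa> * r * (norm v)\<^sup>2)\<bar> \<le> C * r\<^sup>2" using L[OF r(1,2) v] by blast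
      \<comment> \<open>Moving inward by \<open>d = R - norm v ^ 2\<close> raises the bound on
        \<open>j\<close> to at most \<open>P * (1 + d) \<le> P * exp d\<close>, which the loss in
        \<open>exp (norm v ^ 2)\<close> compensates exactly.\<close>
      have "j \<le> P + 2 * \<kappa> * r * (R - (norm v)\<^sup>2)" using j(2) by (simp add: P_def algebra_simps)
      also have "\<dots> \<le> P + P * (R - (norm v)\<^sup>2)" using P v by (intro add_left_mono mult_right_mono) auto
      also have "\<dots> = P * (1 + (R - (norm v)\<^sup>2))" by (simp add: algebra_simps)
      also have "\<dots> \<le> P * exp (R - (norm v)\<^sup>2)" using P0 by (intro mult_left_mono) auto
      finally have "exp ((norm v)\<^sup>2) * j \<le> exp ((norm v)\<^sup>2) * (P * exp (R - (norm v)\<^sup>2))" by simp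
      also have "\<dots> = exp R * P" by (simp add: exp_diff)
      finally show "L_fun Sigma (mu_ball th Sigma) r (th + A *v v) \<le> ennreal (exp R * P)"
        unfolding j(1) by (rule ennreal_leI)
    qed
    \<comment> \<open>\<open>enn2real\<close> sends infinity to 0, so \<open>g\<close> represents
      \<open>l\<close> only after finiteness is known.\<close>
    have "l r \<noteq> top" using upper by (auto simp: top_unique)
    then show lg: "l r = ennreal (g r)" by (simp add: g_def less_top)
    have g0: "0 \<le> g r" by (simp add: g_def)
    have up: "g r \<le> exp R * P" using upper P0 unfolding lg by (simp add: ennreal_le_iff)
    \<comment> \<open>A single boundary point suffices for the lower bound.\<close>
    obtain v :: "real^'n" where v: "(norm v)\<^sup>2 = R" using obtain_norm_square[OF R] .
    obtain j where j: "L_fun Sigma (mu_ball th Sigma) r (th + A *v v) = ennreal (exp R * j)"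
      "\<bar>j - (1 - 2 * \<kappa> * r * R)\<bar> \<le> C * r\<^sup>2" using L[OF r(1,2), of v] v by auto
    have "ennreal (exp R * j) \<le> l r"
      unfolding l_def l_fun_whitened[OF U] j(1)[symmetric] using v by (intro SUP_upper) simp
    then have "exp R * j \<le> g r" using g0 unfolding lg by (simp add: ennreal_le_iff)
    moreover have "exp R * (1 - 2 * \<kappa> * r * R - C * r\<^sup>2) \<le> exp R * j" using j(2) by (intro mult_left_mono) auto
    ultimately show "\<bar>g r - exp R * (1 - 2 * \<kappa> * r * R)\<bar> \<le> exp R * C * r\<^sup>2"
      using up by (simp add: P_def algebra_simps)
  qed
  \<comment> \<open>Below \<open>b\<close> both \<open>r \<le> 1\<close> and the smallness condition
    of \<open>bounds\<close> hold.\<close>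
  define b where "b = min 1 (1 / (2 * \<kappa> * (R + 1)))"
  have b: "0 < b" using \<kappa> R by (simp add: b_def)
  have small: "eventually (\<lambda>r. 0 < r \<and> r \<le> 1 \<and> 2 * \<kappa> * r * (R + 1) \<le> 1) (at_right 0)"
    unfolding eventually_at_right_field
  proof (intro exI[of _ b] conjI b allI impI)
    fix r assume r: "0 < r" "r < b"
    then show "r \<le> 1" by (simp add: b_def)
    have "0 < 2 * \<kappa> * (R + 1)" using \<kappa> R by simp
    then show "2 * \<kappa> * r * (R + 1) \<le> 1" using r by (simp add: b_def field_simps)
  qed
  have g0: "g 0 = exp R" by (simp add: g_def l0)
  have "((\<lambda>r. (g r - g 0) / r - - (2 * \<kappa> * R * exp R)) \<longlongrightarrow> 0) (at_right 0)"
  proof (rule Lim_null_comparison)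
    show "eventually (\<lambda>r. norm ((g r - g 0) / r - - (2 * \<kappa> * R * exp R)) \<le> exp R * C * r) (at_right 0)"
      using small
    proof eventually_elim
      \<comment> \<open>The deviation from the linear approximation is \<open>O(r^2)\<close>, so
        after division by \<open>r\<close> it still tends to 0.\<close>
      case (elim r)
      have "(g r - g 0) / r - - (2 * \<kappa> * R * exp R) = (g r - exp R * (1 - 2 * \<kappa> * r * R)) / r"
        using elim by (simp add: g0 field_simps)
      then show ?case using bounds(2)[of r] elim by (simp add: abs_divide divide_le_eq power2_eq_square mult.assoc)
    qed
    show "((\<lambda>r. exp R * C * r) \<longlongrightarrow> 0) (at_right 0)"
      by (auto intro!: tendsto_eq_intros)
  qed
  then have lim: "((\<lambda>r. (g r - g 0) / r) \<longlongrightarrow> - (2 * \<kappa> * R * exp R)) (at_right 0)"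
    by (rule LIM_zero_cancel)
  have "((\<lambda>r. (enn2ereal (l r) - enn2ereal (l 0)) / ereal r) \<longlongrightarrow> ereal (- (2 * \<kappa> * R * exp R))) (at_right 0)"
  proof (rule tendsto_ereal_difference_quotient[OF _ _ _ lim])
    show "eventually (\<lambda>r. l r = ennreal (g r) \<and> 0 \<le> g r) (at_right 0)"
      using small by eventually_elim (use bounds(1) in \<open>simp add: g_def\<close>)
  qed (simp_all add: g0 l0)
  with \<kappa> that show thesis by blast
qed

end

section \<open>Negativity of the derivative for both mixing families\<close>

theorem corollary4p4p2:
  fixes Sigma :: "real^'n^'n" and th :: "real^'n" and \<alpha> :: real and n :: nat
    and \<mu> :: "real \<Rightarrow> (real^'n) measure" and l :: "real \<Rightarrow> ennreal"
  assumes "pos_def Sigma"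
    and "0 < \<alpha>" and "\<alpha> < 1"
    and "1 \<le> n"
    and "\<mu> \<in> {mu_ball th Sigma, mu_gauss th Sigma}"
  defines "l \<equiv> l_fun Sigma \<mu> (U_data th Sigma \<alpha> n)"
  shows "\<exists>c::real. c < 0 \<and>
    ((\<lambda>r. (enn2ereal (l r) - enn2ereal (l 0)) / ereal r) \<longlongrightarrow> ereal c) (at_right 0)"
proof -
  interpret whitening Sigma "matrix_sqrt Sigma" th using whitening_matrix_sqrt[OF assms(1)] .
  define q where "q = quantile (chi_square_dist CARD('n)) (1 - \<alpha>)"
  have q: "0 < q" unfolding q_def using assms by (intro quantile_chi_square_dist_pos) auto
  define R where "R = ln (1 + q / n)"
  \<comment> \<open>Strict positivity of \<open>R\<close> is what makes both limits strictly
    negative.\<close>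
  have R: "0 < R" unfolding R_def using q assms(4) by (intro ln_gt_zero) simp
  have U: "U_data th Sigma \<alpha> n = (\<lambda>v. th + matrix_sqrt Sigma *v v) ` {v. (norm v)\<^sup>2 \<le> R}"
    unfolding R_def q_def by (rule U_data_whitened) (use q assms(4) in \<open>simp_all add: q_def\<close>)
  consider "\<mu> = mu_ball th Sigma" | "\<mu> = mu_gauss th Sigma" using assms(5) by blast
  then show ?thesis
  proof cases
    case 1
    obtain \<kappa> :: real where "0 < \<kappa>"
      "((\<lambda>r. (enn2ereal (l r) - enn2ereal (l 0)) / ereal r) \<longlongrightarrow> ereal (- (2 * \<kappa> * R * exp R))) (at_right 0)"
      using l_fun_ball_derivative[OF refl U less_imp_le[OF R]] unfolding l_def 1 by blast
    then show ?thesis using R by (intro exI[of _ "- (2 * \<kappa> * R * exp R)"]) simp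
  next
    case 2
    show ?thesis using l_fun_gauss_derivative[OF U less_imp_le[OF R]] R unfolding l_def 2
      by (intro exI[of _ "- (2 * R * exp R)"]) simp
  qed
qed

end
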